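(* Let $\Theta\subset\mathbb{R}^p$ be a nonempty connected open set and, for each $\theta\in\Theta$, let $f_\theta:\mathbb{R}^n\to\mathbb{R}$ be convex and $C^{1}$ with $\beta$-Lipschitz gradient and $g_\theta:\mathbb{R}^n\to\mathbb{R}\cup\{+\infty\}$ closed convex proper, where $\beta>0$ does not depend on $\theta$. Assume that either $f_\theta$ is $\alpha$-strongly convex for all $\theta$ or $g_\theta$ is $\alpha$-strongly convex for all $\theta$, with $\alpha>0$ independent of $\theta$. Let $\gamma=\frac{\alpha}{(\alpha+\beta)^2}$ and assume the maps $T(\theta,x):=\mathrm{prox}_{\gamma g_\theta}(x)$ and $(\theta,x)\mapsto\nabla f_\theta(x)$ are path differentiable jointly in $(\theta,x)\in\Theta\times\mathbb{R}^n$. Then for each $\theta\in\Theta$ the problem $\min_{x\in\mathbb{R}^n} f_\theta(x)+g_\theta(x)$ has a unique solution $x^\star(\theta)$, and $\theta\mapsto x^\star(\theta)$ is path differentiable on $\Theta$ with conservative Jacobian $$\mathcal{J}_{x^\star}(\theta)=\Big\{\big(\mathrm{Id}_n-V(\mathrm{Id}_n-\gamma Z)\big)^{-1}\big(U-\gamma VW\big)\ :\ [U\ V]\in\mathrm{Jac}^c_T\big(\theta,x^\star(\theta)-\gamma\nabla f_\theta(x^\star(\theta))\big),\ [W\ Z]\in\mathrm{Jac}^c_{\nabla f}(\theta,x^\star(\theta))\Big\},$$ where $\mathrm{Jac}^c_{\nabla f}$ is the joint Clarke Jacobian of $(\theta,x)\mapsto\nabla f_\theta(x)$.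
   Context: Clarke Jacobian: for a locally Lipschitz $f:\mathbb{R}^N\to\mathbb{R}^m$, $\mathrm{Jac}^c_f(z)=\mathrm{conv}\{\lim_k \mathrm{Jac}_f(z_k): z_k\to z,\ f \text{ differentiable at } z_k\}$. A conservative Jacobian for a locally Lipschitz $f:\mathbb{R}^N\to\mathbb{R}^m$ is a set-valued map $\mathcal{J}_f:\mathbb{R}^N\rightrightarrows\mathbb{R}^{m\times N}$ with nonempty values, locally bounded, with closed graph, such that for every absolutely continuous curve $c:[0,1]\to\mathbb{R}^N$, for almost every $t\in[0,1]$, $\frac{d}{dt}f(c(t))=M\dot c(t)$ for all $M\in\mathcal{J}_f(c(t))$. $f$ is path differentiable if it is locally Lipschitz and admits a conservative Jacobian. For $f(\theta,x)$ with $\theta\in\mathbb{R}^p$, $x\in\mathbb{R}^n$, Jacobians are written in block form $[U\ V]$ with $U$ the $\theta$-block and $V$ the $x$-block (blocks of the joint Jacobian). $\mathrm{prox}_g(x)=\mathrm{argmin}_u\, g(u)+\frac12\|x-u\|^2$. *)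

theory Defs
  imports "HOL-Analysis.Analysis"
begin

definition abs_cont_on :: "real \<Rightarrow> real \<Rightarrow> (real \<Rightarrow> 'a::real_normed_vector) \<Rightarrow> bool" where
  "abs_cont_on a b c \<longleftrightarrow>
     (\<forall>e>0. \<exists>d>0. \<forall>(I::nat \<Rightarrow> real \<times> real) k.
        (\<forall>i<k. a \<le> fst (I i) \<and> fst (I i) \<le> snd (I i) \<and> snd (I i) \<le> b) \<and>
        (\<forall>i<k. \<forall>j<k. i \<noteq> j \<longrightarrow> snd (I i) \<le> fst (I j) \<or> snd (I j) \<le> fst (I i)) \<and>
        (\<Sum>i<k. snd (I i) - fst (I i)) < d
        \<longrightarrow> (\<Sum>i<k. norm (c (snd (I i)) - c (fst (I i)))) < e)"

definition locally_lipschitz_on :: "'a::metric_space set \<Rightarrow> ('a \<Rightarrow> 'b::metric_space) \<Rightarrow> bool" where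
  "locally_lipschitz_on S F \<longleftrightarrow> (\<forall>z\<in>S. \<exists>e>0. \<exists>L. L-lipschitz_on (ball z e \<inter> S) F)"

definition clarke_jac :: "(real^'N \<Rightarrow> real^'m) \<Rightarrow> real^'N \<Rightarrow> (real^'N^'m) set" where
  "clarke_jac F z = convex hull
     {M. \<exists>zs Ms. zs \<longlonglongrightarrow> z \<and> (\<forall>k. (F has_derivative (\<lambda>h. Ms k *v h)) (at (zs k))) \<and> Ms \<longlonglongrightarrow> M}"

definition conservative_jac_on ::
  "(real^'N) set \<Rightarrow> (real^'N \<Rightarrow> real^'m) \<Rightarrow> (real^'N \<Rightarrow> (real^'N^'m) set) \<Rightarrow> bool" where
  "conservative_jac_on S F J \<longleftrightarrow>
     (\<forall>z\<in>S. J z \<noteq> {}) \<and>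
     (\<forall>z\<in>S. \<exists>e>0. bounded (\<Union> (J ` (ball z e \<inter> S)))) \<and>
     closedin (top_of_set (S \<times> UNIV)) (SIGMA z:S. J z) \<and>
     (\<forall>c. abs_cont_on 0 1 c \<and> c ` {0..1} \<subseteq> S \<longrightarrow>
        (\<exists>N \<in> null_sets lebesgue. \<forall>t \<in> {0..1} - N.
           \<exists>v. (c has_vector_derivative v) (at t) \<and>
               (\<forall>M \<in> J (c t). ((F \<circ> c) has_vector_derivative (M *v v)) (at t))))"

definition path_diff_on :: "(real^'N) set \<Rightarrow> (real^'N \<Rightarrow> real^'m) \<Rightarrow> bool" where
  "path_diff_on S F \<longleftrightarrow> locally_lipschitz_on S F \<and>
     (\<exists>J :: real^'N \<Rightarrow> (real^'N^'m) set. conservative_jac_on S F J)"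

definition join :: "real^'p \<Rightarrow> real^'n \<Rightarrow> real^('p::finite + 'n::finite)" where
  "join th x = (\<chi> i. case i of Inl j \<Rightarrow> th $ j | Inr j \<Rightarrow> x $ j)"

definition part1 :: "real^('p::finite + 'n::finite) \<Rightarrow> real^'p" where
  "part1 z = (\<chi> j. z $ Inl j)"

definition part2 :: "real^('p::finite + 'n::finite) \<Rightarrow> real^'n" where
  "part2 z = (\<chi> j. z $ Inr j)"

definition blockU :: "real^('p::finite + 'n::finite)^'m \<Rightarrow> real^'p^'m" where
  "blockU M = (\<chi> i j. M $ i $ Inl j)"

definition blockV :: "real^('p::finite + 'n::finite)^'m \<Rightarrow> real^'n^'m" where
  "blockV M = (\<chi> i j. M $ i $ Inr j)"

definition grad :: "(real^'n \<Rightarrow> real) \<Rightarrow> real^'n \<Rightarrow> real^'n" where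
  "grad f x = (SOME v. (f has_derivative (\<lambda>h. v \<bullet> h)) (at x))"

definition ext_convex :: "(real^'n \<Rightarrow> ereal) \<Rightarrow> bool" where
  "ext_convex g \<longleftrightarrow> (\<forall>x y t. 0 \<le> t \<and> t \<le> 1 \<longrightarrow>
      g (t *\<^sub>R x + (1 - t) *\<^sub>R y) \<le> ereal t * g x + ereal (1 - t) * g y)"

definition ext_strongly_convex :: "real \<Rightarrow> (real^'n \<Rightarrow> ereal) \<Rightarrow> bool" where
  "ext_strongly_convex \<alpha> g \<longleftrightarrow> (\<forall>x y t. 0 \<le> t \<and> t \<le> 1 \<longrightarrow>
      g (t *\<^sub>R x + (1 - t) *\<^sub>R y)
        \<le> ereal t * g x + ereal (1 - t) * g y - ereal (\<alpha> / 2 * t * (1 - t) * (norm (x - y))\<^sup>2))"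

text \<open>Closed = closed epigraph (equivalently lower semicontinuous).\<close>
definition ext_closed :: "(real^'n \<Rightarrow> ereal) \<Rightarrow> bool" where
  "ext_closed g \<longleftrightarrow> closed {(x, r::real). g x \<le> ereal r}"

definition ext_proper :: "(real^'n \<Rightarrow> ereal) \<Rightarrow> bool" where
  "ext_proper g \<longleftrightarrow> (\<forall>x. g x \<noteq> -\<infinity>) \<and> (\<exists>x. g x \<noteq> \<infinity>)"

definition prox :: "(real^'n \<Rightarrow> ereal) \<Rightarrow> real^'n \<Rightarrow> real^'n" where
  "prox g x = (SOME u. \<forall>v. g u + ereal ((norm (x - u))\<^sup>2 / 2) \<le> g v + ereal ((norm (x - v))\<^sup>2 / 2))"

definition is_minimizer :: "(real^'n \<Rightarrow> ereal) \<Rightarrow> real^'n \<Rightarrow> bool" where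
  "is_minimizer F x \<longleftrightarrow> (\<forall>y. F x \<le> F y)"

end

theory Submission
  imports Defs
begin

text \<open>
  The solution is the fixed point of the forward-backward map \<open>x \<mapsto> T (\<theta>, x - \<gamma> \<nabla>f\<^sub>\<theta> x)\<close>. Strong
  monotonicity of the gradient, or the contraction property of the proximal map, makes this a uniform
  contraction for the given \<open>\<gamma>\<close>, so the solution is locally Lipschitz in \<open>\<theta>\<close>; the contraction
  estimates pass to the Clarke Jacobians and make \<open>Id - V (Id - \<gamma> Z)\<close> invertible. Differentiating the
  fixed point equation along an absolutely continuous curve then gives the formula, provided the
  Clarke Jacobian of a path differentiable map is nonempty and obeys the chain rule along curves.

  The chain rule holds since integration along short segments shows that the Clarke Jacobian is
  dominated, when tested on pairs of vectors, by any conservative Jacobian. For nonemptiness, Baire's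
  theorem shows that a conservative Jacobian is single-valued on a dense set, and the map is
  differentiable at each such point.
\<close>

text \<open>The value of \<open>\<gamma>\<close> enters through \<gamma> * \<beta>^2 < \<alpha>, a
  consequence of \<beta> < \<alpha> + \<beta>. The gradient step is estimated from monotonicity and
  the Lipschitz bound, without cocoercivity, which gives the factor sqrt (1 - 2 \<gamma> \<mu>f +
  \<gamma>^2 \<beta>^2); the proximal map contributes 1 / (1 + \<gamma> \<mu>g). The moduli (\<mu>f,
  \<mu>g) are (\<alpha>, 0) or (0, \<alpha>). In the second case the first factor exceeds 1 and the
  proximal map has to compensate, so it is the product of the two factors that is compared with 1.

  Estimates reach the Clarke Jacobian by one device: a closed convex set of matrices that contains
  all derivatives near a point contains the Clarke Jacobian there.

  The obstacle is that a conservative Jacobian speaks about almost every time along a curve and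
  never about a single point. Pointwise information is recovered from increments over short segments
  and upper semicontinuity.\<close>

section \<open>Strongly convex extended-valued functions and the proximal map\<close>

text \<open>Strong convexity tested on points of the epigraph: the bounds \<open>a\<close> and
  \<open>b\<close> are real, so no arithmetic with infinite values occurs. The modulus 0 is plain
  convexity.\<close>

definition epi_convex :: "real \<Rightarrow> (real^'n \<Rightarrow> ereal) \<Rightarrow> bool" where
  "epi_convex \<mu> h \<longleftrightarrow> (\<forall>x y a b t. h x \<le> ereal a \<longrightarrow> h y \<le> ereal b \<longrightarrow> 0 \<le> t \<longrightarrow> t \<le> 1 \<longrightarrow>
     h (t *\<^sub>R x + (1 - t) *\<^sub>R y) \<le> ereal (t * a + (1 - t) * b - \<mu> / 2 * t * (1 - t) * (norm (x - y))\<^sup>2))"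

lemma epi_convexD:
  assumes "epi_convex \<mu> h" "h x \<le> ereal a" "h y \<le> ereal b" "0 \<le> t" "t \<le> 1"
  shows "h (t *\<^sub>R x + (1 - t) *\<^sub>R y) \<le> ereal (t * a + (1 - t) * b - \<mu> / 2 * t * (1 - t) * (norm (x - y))\<^sup>2)"
  using assms unfolding epi_convex_def by blast

lemma ext_strongly_convex_imp_epi_convex:
  assumes "ext_strongly_convex \<mu> h"
  shows "epi_convex \<mu> h"
  unfolding epi_convex_def
proof (intro allI impI)
  fix x y and a b t :: real
  assume a: "h x \<le> ereal a" and b: "h y \<le> ereal b" and t: "0 \<le> t" "t \<le> 1"
  let ?q = "\<mu> / 2 * t * (1 - t) * (norm (x - y))\<^sup>2"
  have "h (t *\<^sub>R x + (1 - t) *\<^sub>R y) \<le> ereal t * h x + ereal (1 - t) * h y - ereal ?q"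
    using assms t unfolding ext_strongly_convex_def by blast
  also have "\<dots> \<le> ereal t * ereal a + ereal (1 - t) * ereal b - ereal ?q"
    using a b t by (intro ereal_minus_mono add_mono ereal_mult_left_mono) auto
  finally show "h (t *\<^sub>R x + (1 - t) *\<^sub>R y) \<le> ereal (t * a + (1 - t) * b - ?q)"
    by simp
qed

lemma ext_convex_imp_epi_convex:
  assumes "ext_convex h"
  shows "epi_convex 0 h"
proof (rule ext_strongly_convex_imp_epi_convex)
  show "ext_strongly_convex 0 h"
    using assms unfolding ext_strongly_convex_def ext_convex_def
    by (simp add: zero_ereal_def[symmetric])
qed

lemma convex_on_imp_epi_convex:
  assumes "convex_on UNIV f"
  shows "epi_convex 0 (\<lambda>x. ereal (f x))"
  unfolding epi_convex_def
proof (intro allI impI)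
  fix x y and a b t :: real
  assume a: "ereal (f x) \<le> ereal a" and b: "ereal (f y) \<le> ereal b" and t: "0 \<le> t" "t \<le> 1"
  have "f (t *\<^sub>R x + (1 - t) *\<^sub>R y) \<le> t * f x + (1 - t) * f y"
    using convex_onD[OF assms, of "1 - t" x y] t by simp
  also have "\<dots> \<le> t * a + (1 - t) * b"
    using a b t by (intro add_mono mult_left_mono) auto
  finally show "ereal (f (t *\<^sub>R x + (1 - t) *\<^sub>R y)) \<le> ereal (t * a + (1 - t) * b - 0 / 2 * t * (1 - t) * (norm (x - y))\<^sup>2)"
    by simp
qed

lemma epi_convex_add_real:
  assumes g: "epi_convex \<mu> g" and f: "epi_convex \<nu> (\<lambda>x. ereal (f x))"
  shows "epi_convex (\<mu> + \<nu>) (\<lambda>x. g x + ereal (f x))"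
  unfolding epi_convex_def
proof (intro allI impI)
  fix x y and a b t :: real
  assume a: "g x + ereal (f x) \<le> ereal a" and b: "g y + ereal (f y) \<le> ereal b" and t: "0 \<le> t" "t \<le> 1"
  have "g x \<le> ereal (a - f x)" using a by (cases "g x") auto
  moreover have "g y \<le> ereal (b - f y)" using b by (cases "g y") auto
  ultimately have "g (t *\<^sub>R x + (1 - t) *\<^sub>R y)
      \<le> ereal (t * (a - f x) + (1 - t) * (b - f y) - \<mu> / 2 * t * (1 - t) * (norm (x - y))\<^sup>2)"
    using t by (intro epi_convexD[OF g])
  moreover have "ereal (f (t *\<^sub>R x + (1 - t) *\<^sub>R y))
      \<le> ereal (t * f x + (1 - t) * f y - \<nu> / 2 * t * (1 - t) * (norm (x - y))\<^sup>2)"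
    using t by (intro epi_convexD[OF f]) auto
  ultimately have "g (t *\<^sub>R x + (1 - t) *\<^sub>R y) + ereal (f (t *\<^sub>R x + (1 - t) *\<^sub>R y))
     \<le> ereal (t * (a - f x) + (1 - t) * (b - f y) - \<mu> / 2 * t * (1 - t) * (norm (x - y))\<^sup>2)
       + ereal (t * f x + (1 - t) * f y - \<nu> / 2 * t * (1 - t) * (norm (x - y))\<^sup>2)"
    by (rule add_mono)
  then show "g (t *\<^sub>R x + (1 - t) *\<^sub>R y) + ereal (f (t *\<^sub>R x + (1 - t) *\<^sub>R y))
     \<le> ereal (t * a + (1 - t) * b - (\<mu> + \<nu>) / 2 * t * (1 - t) * (norm (x - y))\<^sup>2)"
    by (simp add: algebra_simps add_divide_distrib)
qed

lemma ereal_mult_le_iff: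
  assumes "0 < c"
  shows "ereal c * x \<le> ereal r \<longleftrightarrow> x \<le> ereal (r / c)"
  using assms by (cases x) (auto simp: field_simps)

lemma epi_convex_cmult:
  assumes g: "epi_convex \<mu> g" and c: "0 < c"
  shows "epi_convex (c * \<mu>) (\<lambda>x. ereal c * g x)"
  unfolding epi_convex_def ereal_mult_le_iff[OF c]
proof (intro allI impI)
  fix x y and a b t :: real
  assume "g x \<le> ereal (a / c)" "g y \<le> ereal (b / c)" "0 \<le> t" "t \<le> 1"
  from epi_convexD[OF g this]
  show "g (t *\<^sub>R x + (1 - t) *\<^sub>R y)
      \<le> ereal ((t * a + (1 - t) * b - c * \<mu> / 2 * t * (1 - t) * (norm (x - y))\<^sup>2) / c)"
    using c by (simp add: field_simps)
qed

text \<open>In an inner product space the strong convexity inequality with modulus 1 is an identity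
  for half the squared distance. This term makes every proximal objective strongly convex.\<close>

lemma epi_convex_half_norm_sq: "epi_convex 1 (\<lambda>u. ereal ((norm (x - u))\<^sup>2 / 2))"
  unfolding epi_convex_def
proof (intro allI impI)
  fix y z and a b t :: real
  assume a: "ereal ((norm (x - y))\<^sup>2 / 2) \<le> ereal a" and b: "ereal ((norm (x - z))\<^sup>2 / 2) \<le> ereal b"
    and t: "0 \<le> t" "t \<le> 1"
  have "(norm (x - (t *\<^sub>R y + (1 - t) *\<^sub>R z)))\<^sup>2 / 2
      = t * ((norm (x - y))\<^sup>2 / 2) + (1 - t) * ((norm (x - z))\<^sup>2 / 2) - 1 / 2 * t * (1 - t) * (norm (y - z))\<^sup>2"
    unfolding power2_norm_eq_inner
    by (simp add: algebra_simps inner_commute power2_eq_square add_divide_distrib diff_divide_distrib)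
  also have "\<dots> \<le> t * a + (1 - t) * b - 1 / 2 * t * (1 - t) * (norm (y - z))\<^sup>2"
    using a b t by (intro diff_right_mono add_mono mult_left_mono) auto
  finally show "ereal ((norm (x - (t *\<^sub>R y + (1 - t) *\<^sub>R z)))\<^sup>2 / 2)
      \<le> ereal (t * a + (1 - t) * b - 1 / 2 * t * (1 - t) * (norm (y - z))\<^sup>2)"
    by simp
qed

section \<open>Closed epigraphs and existence of minimizers\<close>

lemma ext_closedD:
  assumes "ext_closed h" "X \<longlonglongrightarrow> x" "R \<longlonglongrightarrow> r" "\<And>n::nat. h (X n) \<le> ereal (R n)"
  shows "h x \<le> ereal r"
proof -
  have "(\<lambda>n. (X n, R n)) \<longlonglongrightarrow> (x, r)" using assms by (intro tendsto_Pair)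
  then have "(x, r) \<in> {(x, r::real). h x \<le> ereal r}"
    using assms(1,4) unfolding ext_closed_def by (elim closed_sequentially[rotated 2]) auto
  then show ?thesis by simp
qed

lemma ext_closedI:
  assumes "\<And>X R x r. X \<longlonglongrightarrow> x \<Longrightarrow> R \<longlonglongrightarrow> r \<Longrightarrow> (\<And>n::nat. h (X n) \<le> ereal (R n)) \<Longrightarrow> h x \<le> ereal r"
  shows "ext_closed h"
  unfolding ext_closed_def closed_sequential_limits
proof (intro allI impI, elim conjE)
  fix S l assume S: "\<forall>n::nat. S n \<in> {(x, r::real). h x \<le> ereal r}" and l: "S \<longlonglongrightarrow> l"
  have "h (fst l) \<le> ereal (snd l)"
  proof (rule assms)
    show "(\<lambda>n. fst (S n)) \<longlonglongrightarrow> fst l" "(\<lambda>n. snd (S n)) \<longlonglongrightarrow> snd l"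
      using l by (rule tendsto_fst, rule tendsto_snd)
    show "h (fst (S n)) \<le> ereal (snd (S n))" for n using spec[OF S, of n] by (simp add: case_prod_unfold)
  qed
  then show "l \<in> {(x, r). h x \<le> ereal r}" by (auto simp: case_prod_unfold)
qed

lemma ext_closed_add_real:
  assumes g: "ext_closed g" and f: "continuous_on UNIV f"
  shows "ext_closed (\<lambda>x. g x + ereal (f x))"
proof (rule ext_closedI)
  fix X R x r assume X: "X \<longlonglongrightarrow> x" and R: "R \<longlonglongrightarrow> r" and le: "\<And>n::nat. g (X n) + ereal (f (X n)) \<le> ereal (R n)"
  have "g (X n) \<le> ereal (R n - f (X n))" for n
    using le[of n] by (cases "g (X n)") auto
  moreover have "(\<lambda>n. R n - f (X n)) \<longlonglongrightarrow> r - f x"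
    using f R X by (intro tendsto_diff) (auto intro: continuous_on_tendsto_compose)
  ultimately have "g x \<le> ereal (r - f x)" using ext_closedD[OF g X] by blast
  then show "g x + ereal (f x) \<le> ereal r" by (cases "g x") auto
qed

lemma ext_closed_cmult:
  assumes g: "ext_closed g" and c: "0 < c"
  shows "ext_closed (\<lambda>x. ereal c * g x)"
proof (rule ext_closedI)
  fix X R x r assume X: "X \<longlonglongrightarrow> x" and R: "R \<longlonglongrightarrow> r" and le: "\<And>n::nat. ereal c * g (X n) \<le> ereal (R n)"
  have "(\<lambda>n. R n / c) \<longlonglongrightarrow> r / c" using R c by (intro tendsto_divide) auto
  with ext_closedD[OF g X] le show "ereal c * g x \<le> ereal r"
    by (simp add: ereal_mult_le_iff[OF c])
qed

lemma ext_proper_add_real: "ext_proper g \<Longrightarrow> ext_proper (\<lambda>x. g x + ereal (f x))"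
  unfolding ext_proper_def by auto

lemma ext_proper_cmult: "ext_proper g \<Longrightarrow> 0 < c \<Longrightarrow> ext_proper (\<lambda>x. ereal c * g x)"
  unfolding ext_proper_def by (auto simp: ereal_mult_eq_MInfty ereal_mult_eq_PInfty)

text \<open>A minimizing sequence subconverges in \<open>K\<close>. The infimum may be infinite, so
  closedness of the epigraph is applied at real levels \<open>r\<close> above it, where the tail of
  the sequence lies below \<open>r\<close>.\<close>

lemma ext_closed_attains_min:
  assumes cl: "ext_closed h" and K: "compact K" "K \<noteq> {}"
  shows "\<exists>x\<in>K. \<forall>y\<in>K. h x \<le> h y"
proof -
  define m where "m = (INF y\<in>K. h y)"
  obtain Y where Y: "range Y \<subseteq> h ` K" "Y \<longlonglongrightarrow> m"
    using Inf_as_limit[of "h ` K"] K unfolding m_def by auto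
  then have "\<forall>n. \<exists>x\<in>K. Y n = h x" by auto
  then obtain X where X: "\<And>n. X n \<in> K" "\<And>n. Y n = h (X n)" by metis
  obtain x s where x: "x \<in> K" "strict_mono s" "(X \<circ> s) \<longlonglongrightarrow> x"
    using K(1)[unfolded compact_def, rule_format, of X] X(1) by blast
  have "h x \<le> m"
  proof (rule dense_ge)
    fix r' assume "m < r'"
    then obtain r where r: "m < ereal r" "ereal r < r'" using ereal_dense2 by blast
    have "\<forall>\<^sub>F n in sequentially. Y (s n) < ereal r"
      using LIMSEQ_subseq_LIMSEQ[OF Y(2) x(2)] r by (auto simp: order_tendsto_iff o_def)
    then obtain N where N: "\<And>n. n \<ge> N \<Longrightarrow> h (X (s n)) < ereal r"
      using X(2) unfolding eventually_sequentially by metis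
    have "h x \<le> ereal r"
    proof (rule ext_closedD[OF cl _ tendsto_const])
      show "(\<lambda>n. X (s (n + N))) \<longlonglongrightarrow> x"
        using LIMSEQ_ignore_initial_segment[OF x(3), of N] by (simp add: o_def)
      show "h (X (s (n + N))) \<le> ereal r" for n using N[of "n + N"] by simp
    qed
    then show "h x \<le> r'" using r by auto
  qed
  then show ?thesis using x unfolding m_def by (meson INF_lower order_trans)
qed

lemma is_minimizer_finite:
  assumes "ext_proper h" "is_minimizer h x"
  obtains a where "h x = ereal a"
proof -
  have "h x \<noteq> -\<infinity>" "h x \<noteq> \<infinity>" using assms unfolding ext_proper_def is_minimizer_def by auto
  with that show ?thesis by (cases "h x") auto
qed

text \<open>Minimality is compared with convexity at t y + (1 - t) x. After division by t the
  modulus carries a factor 1 - t, and letting t tend to 0 restores it in full.\<close>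

lemma is_minimizer_quadratic_growth:
  assumes sc: "epi_convex \<mu> h" and mn: "is_minimizer h x"
    and a: "h x = ereal a" and b: "h y \<le> ereal b"
  shows "a + \<mu> / 2 * (norm (y - x))\<^sup>2 \<le> b"
proof -
  have "a \<le> b - \<mu> / 2 * (1 - t) * (norm (y - x))\<^sup>2" if t: "0 < t" "t < 1" for t
  proof -
    have "ereal a \<le> h (t *\<^sub>R y + (1 - t) *\<^sub>R x)" using mn a unfolding is_minimizer_def by metis
    also have "\<dots> \<le> ereal (t * b + (1 - t) * a - \<mu> / 2 * t * (1 - t) * (norm (y - x))\<^sup>2)"
      using t a b by (intro epi_convexD[OF sc]) auto
    finally have "t * a \<le> t * (b - \<mu> / 2 * (1 - t) * (norm (y - x))\<^sup>2)"
      by (simp add: algebra_simps)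
    then show ?thesis using t mult_le_cancel_left_pos by blast
  qed
  then have "\<forall>\<^sub>F t in at_right 0. a \<le> b - \<mu> / 2 * (1 - t) * (norm (y - x))\<^sup>2"
    unfolding eventually_at_right_field by (intro exI[of _ 1]) auto
  moreover have "((\<lambda>t. b - \<mu> / 2 * (1 - t) * (norm (y - x))\<^sup>2) \<longlongrightarrow> b - \<mu> / 2 * (1 - 0) * (norm (y - x))\<^sup>2) (at_right 0)"
    by (intro tendsto_intros)
  ultimately have "a \<le> b - \<mu> / 2 * (1 - 0) * (norm (y - x))\<^sup>2"
    using tendsto_lowerbound trivial_limit_at_right_real by blast
  then show ?thesis by simp
qed

text \<open>Coercivity comes from strong convexity alone: along each ray from a point of the domain, the
  values are controlled from below by the minimum over the unit ball around that point.\<close>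
lemma strongly_convex_ex1_minimizer:
  assumes sc: "epi_convex \<mu> h" and \<mu>: "0 < \<mu>" and cl: "ext_closed h" and pr: "ext_proper h"
  shows "\<exists>!x. is_minimizer h x"
proof -
  obtain x0 where "h x0 \<noteq> \<infinity>" "h x0 \<noteq> -\<infinity>" using pr unfolding ext_proper_def by blast
  then obtain h0 where h0: "h x0 = ereal h0" by (cases "h x0") auto
  obtain p where p: "\<And>y. y \<in> cball x0 1 \<Longrightarrow> h p \<le> h y"
    using ext_closed_attains_min[OF cl, of "cball x0 1"] by fastforce
  have "h p \<le> ereal h0" using p[of x0] h0 by simp
  moreover have "h p \<noteq> -\<infinity>" using pr unfolding ext_proper_def by blast
  ultimately obtain m where m: "h p = ereal m" by (cases "h p") auto
  \<comment> \<open>Chosen so that \<mu>/2 * (R - 1) = h0 - m + 1. If some \<open>y\<close> beyond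
    radius \<open>R\<close> had value at most \<open>h0\<close>, the point at distance 1 from
    \<open>x0\<close> on the segment to \<open>y\<close> would have value at most m - 1, below the
    minimum over the unit ball.\<close>
  define R where "R = 1 + 2 * (h0 - m + 1) / \<mu>"
  have mh: "m \<le> h0" using \<open>h p \<le> ereal h0\<close> m by simp
  have R: "R > 1" unfolding R_def using mh \<mu> by (simp add: add_pos_pos)
  have far: "ereal h0 \<le> h y" if y: "norm (y - x0) > R" for y
  proof (rule ccontr)
    assume "\<not> ereal h0 \<le> h y"
    then have hy: "h y \<le> ereal h0" by simp
    define r where "r = norm (y - x0)"
    define t where "t = 1 / r"
    have r: "r > R" "r > 1" "r > 0" using y R r_def by auto
    have t: "0 < t" "t < 1" "t * r = 1" using r unfolding t_def by auto
    let ?q = "t *\<^sub>R y + (1 - t) *\<^sub>R x0"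
    have "?q - x0 = t *\<^sub>R (y - x0)" by (simp add: algebra_simps)
    then have "norm (?q - x0) = 1" using t r_def by simp
    then have "?q \<in> cball x0 1" by (simp add: dist_norm norm_minus_commute)
    then have "ereal m \<le> h ?q" using p m by metis
    also have "\<dots> \<le> ereal (t * h0 + (1 - t) * h0 - \<mu> / 2 * t * (1 - t) * (norm (y - x0))\<^sup>2)"
      using t h0 hy by (intro epi_convexD[OF sc]) auto
    finally have 1: "m \<le> h0 - \<mu> / 2 * t * (1 - t) * r\<^sup>2" by (simp add: algebra_simps r_def)
    have "t * (1 - t) * r\<^sup>2 = (t * r) * (r - t * r)" by (simp add: power2_eq_square algebra_simps)
    then have "t * (1 - t) * r\<^sup>2 = r - 1" using t by simp
    then have "\<mu> / 2 * t * (1 - t) * r\<^sup>2 = \<mu> / 2 * (r - 1)" by (metis mult.assoc)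
    moreover have "\<mu> / 2 * (r - 1) \<ge> \<mu> / 2 * (R - 1)" using r \<mu> by simp
    moreover have "\<mu> / 2 * (R - 1) = h0 - m + 1" unfolding R_def using \<mu> by simp
    ultimately show False using 1 by linarith
  qed
  obtain x where x: "x \<in> cball x0 R" "\<And>y. y \<in> cball x0 R \<Longrightarrow> h x \<le> h y"
    using ext_closed_attains_min[OF cl, of "cball x0 R"] R by auto
  have "is_minimizer h x" unfolding is_minimizer_def
  proof
    fix y show "h x \<le> h y"
    proof (cases "y \<in> cball x0 R")
      case False
      then have "ereal h0 \<le> h y" by (intro far) (auto simp: dist_norm norm_minus_commute)
      moreover have "h x \<le> h x0" using x R by auto
      ultimately show ?thesis using h0 by auto
    qed (use x in auto)
  qed
  moreover have "y = x" if y: "is_minimizer h y" for y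
  proof -
    obtain a where a: "h x = ereal a" using is_minimizer_finite[OF pr \<open>is_minimizer h x\<close>] .
    have "h y \<le> ereal a" using y a unfolding is_minimizer_def by metis
    from is_minimizer_quadratic_growth[OF sc \<open>is_minimizer h x\<close> a this]
    show "y = x" using \<mu> by (simp add: mult_le_0_iff)
  qed
  ultimately show ?thesis by blast
qed

section \<open>Proximal maps\<close>

lemma prox_objective_ex1_minimizer:
  assumes sc: "epi_convex \<mu> g" and \<mu>: "0 \<le> \<mu>" and cl: "ext_closed g" and pr: "ext_proper g"
  shows "\<exists>!u. is_minimizer (\<lambda>u. g u + ereal ((norm (x - u))\<^sup>2 / 2)) u"
  using \<mu> by (intro strongly_convex_ex1_minimizer[OF epi_convex_add_real[OF sc epi_convex_half_norm_sq]]
      ext_closed_add_real ext_proper_add_real cl pr continuous_intros) auto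

lemma is_minimizer_prox:
  assumes "epi_convex \<mu> g" "0 \<le> \<mu>" "ext_closed g" "ext_proper g"
  shows "is_minimizer (\<lambda>u. g u + ereal ((norm (x - u))\<^sup>2 / 2)) (prox g x)"
  using someI_ex[OF ex1_implies_ex[OF prox_objective_ex1_minimizer[OF assms, of x]]]
  unfolding prox_def is_minimizer_def .

lemma prox_eqI:
  assumes "epi_convex \<mu> g" "0 \<le> \<mu>" "ext_closed g" "ext_proper g"
    and "is_minimizer (\<lambda>u. g u + ereal ((norm (x - u))\<^sup>2 / 2)) u"
  shows "prox g x = u"
  using prox_objective_ex1_minimizer[OF assms(1-4), of x] is_minimizer_prox[OF assms(1-4), of x] assms(5)
  by blast

text \<open>Each of the two proximal points minimizes an objective of modulus \<mu> + 1. Testing the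
  quadratic growth of each objective at the other point and adding cancels the values of
  \<open>g\<close>; the squares collapse to an inner product, and Cauchy-Schwarz finishes.\<close>

lemma prox_lipschitz:
  assumes sc: "epi_convex \<mu> g" and \<mu>: "0 \<le> \<mu>" and cl: "ext_closed g" and pr: "ext_proper g"
  shows "norm (prox g x - prox g y) \<le> 1 / (1 + \<mu>) * norm (x - y)"
proof -
  let ?h = "\<lambda>x u. g u + ereal ((norm (x - u))\<^sup>2 / 2)"
  define p q where "p = prox g x" and "q = prox g y"
  have mp: "is_minimizer (?h x) p" and mq: "is_minimizer (?h y) q"
    unfolding p_def q_def by (rule is_minimizer_prox[OF assms])+
  have prh: "ext_proper (?h z)" for z by (rule ext_proper_add_real[OF pr])
  have sch: "epi_convex (\<mu> + 1) (?h z)" for z by (rule epi_convex_add_real[OF sc epi_convex_half_norm_sq])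
  obtain a where "?h x p = ereal a" by (rule is_minimizer_finite[OF prh mp])
  then obtain a where a: "g p = ereal a" by (cases "g p") auto
  obtain b where "?h y q = ereal b" by (rule is_minimizer_finite[OF prh mq])
  then obtain b where b: "g q = ereal b" by (cases "g q") auto
  have 1: "a + (norm (x - p))\<^sup>2 / 2 + (\<mu> + 1) / 2 * (norm (q - p))\<^sup>2 \<le> b + (norm (x - q))\<^sup>2 / 2"
    by (rule is_minimizer_quadratic_growth[OF sch mp]) (auto simp: a b)
  have 2: "b + (norm (y - q))\<^sup>2 / 2 + (\<mu> + 1) / 2 * (norm (p - q))\<^sup>2 \<le> a + (norm (y - p))\<^sup>2 / 2"
    by (rule is_minimizer_quadratic_growth[OF sch mq]) (auto simp: a b)
  have 3: "(norm (x - q))\<^sup>2 + (norm (y - p))\<^sup>2 - (norm (x - p))\<^sup>2 - (norm (y - q))\<^sup>2 = 2 * ((x - y) \<bullet> (p - q))"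
    unfolding power2_norm_eq_inner by (simp add: algebra_simps inner_commute)
  have "(\<mu> + 1) * (norm (p - q))\<^sup>2 \<le> (x - y) \<bullet> (p - q)"
    using 1 2 3 by (simp add: norm_minus_commute algebra_simps add_divide_distrib)
  also have "\<dots> \<le> norm (x - y) * norm (p - q)" by (rule norm_cauchy_schwarz)
  finally have "(\<mu> + 1) * norm (p - q) \<le> norm (x - y)"
    by (cases "norm (p - q) = 0") (auto simp: power2_eq_square mult.assoc[symmetric])
  then show ?thesis using \<mu> unfolding p_def q_def by (simp add: field_simps)
qed

section \<open>Gradients of strongly convex functions and the forward step\<close>

lemma grad_has_derivative:
  assumes "f differentiable (at x)"
  shows "(f has_derivative (\<lambda>h. grad f x \<bullet> h)) (at x)"
proof -
  from assms obtain D where D: "(f has_derivative D) (at x)" unfolding differentiable_def by blast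
  interpret D: bounded_linear D by (rule has_derivative_bounded_linear[OF D])
  have "D h = (\<Sum>i\<in>Basis. D i *\<^sub>R i) \<bullet> h" for h
  proof -
    have "D h = D (\<Sum>i\<in>Basis. (h \<bullet> i) *\<^sub>R i)" by (simp add: euclidean_representation)
    also have "\<dots> = (\<Sum>i\<in>Basis. D i *\<^sub>R i) \<bullet> h"
      by (simp only: D.sum D.scaleR inner_sum_left inner_scaleR_left real_scaleR_def)
        (simp add: inner_commute mult.commute)
    finally show ?thesis .
  qed
  then have "D = (\<lambda>h. (\<Sum>i\<in>Basis. D i *\<^sub>R i) \<bullet> h)" by blast
  with D have "(f has_derivative (\<lambda>h. (\<Sum>i\<in>Basis. D i *\<^sub>R i) \<bullet> h)) (at x)" by simp
  then show ?thesis unfolding grad_def by (rule someI)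
qed

lemma grad_directional_tendsto:
  assumes "f differentiable (at x)"
  shows "((\<lambda>t. (f (x + t *\<^sub>R d) - f x) / t) \<longlongrightarrow> grad f x \<bullet> d) (at_right 0)"
proof -
  have "((\<lambda>t. x + t *\<^sub>R d) has_derivative (\<lambda>t. t *\<^sub>R d)) (at (0::real))"
    by (auto intro!: derivative_eq_intros)
  moreover have "(f has_derivative (\<lambda>h. grad f x \<bullet> h)) (at (x + 0 *\<^sub>R d))"
    using grad_has_derivative[OF assms] by simp
  ultimately have "(f \<circ> (\<lambda>t. x + t *\<^sub>R d) has_derivative (\<lambda>h. grad f x \<bullet> h) \<circ> (\<lambda>t. t *\<^sub>R d)) (at 0)"
    by (rule diff_chain_at)
  then have "((\<lambda>t. f (x + t *\<^sub>R d)) has_real_derivative grad f x \<bullet> d) (at 0)"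
    by (simp add: has_field_derivative_def o_def mult.commute[of _ "grad f x \<bullet> d"])
  then have "((\<lambda>t. (f (x + t *\<^sub>R d) - f x) / t) \<longlongrightarrow> grad f x \<bullet> d) (at 0)"
    by (simp add: DERIV_def)
  then show ?thesis by (rule filterlim_mono) (auto simp: at_within_le_at)
qed

lemma strongly_convex_gradient_ineq:
  assumes sc: "epi_convex \<mu> (\<lambda>x. ereal (f x))" and df: "f differentiable (at x)"
  shows "f x + grad f x \<bullet> (y - x) + \<mu> / 2 * (norm (y - x))\<^sup>2 \<le> f y"
proof -
  have "(f (x + t *\<^sub>R (y - x)) - f x) / t \<le> f y - f x - \<mu> / 2 * (1 - t) * (norm (y - x))\<^sup>2"
    if t: "0 < t" "t < 1" for t
  proof -
    have eq: "x + t *\<^sub>R (y - x) = t *\<^sub>R y + (1 - t) *\<^sub>R x" by (simp add: algebra_simps)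
    have "ereal (f (t *\<^sub>R y + (1 - t) *\<^sub>R x)) \<le> ereal (t * f y + (1 - t) * f x - \<mu> / 2 * t * (1 - t) * (norm (y - x))\<^sup>2)"
      using t by (intro epi_convexD[OF sc]) auto
    then have "f (x + t *\<^sub>R (y - x)) - f x \<le> t * (f y - f x - \<mu> / 2 * (1 - t) * (norm (y - x))\<^sup>2)"
      unfolding eq by (simp add: algebra_simps)
    then show ?thesis using t by (simp add: pos_divide_le_eq mult.commute)
  qed
  then have "\<forall>\<^sub>F t in at_right 0. (f (x + t *\<^sub>R (y - x)) - f x) / t \<le> f y - f x - \<mu> / 2 * (1 - t) * (norm (y - x))\<^sup>2"
    unfolding eventually_at_right_field by (intro exI[of _ 1]) auto
  moreover have "((\<lambda>t. f y - f x - \<mu> / 2 * (1 - t) * (norm (y - x))\<^sup>2)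
      \<longlongrightarrow> f y - f x - \<mu> / 2 * (1 - 0) * (norm (y - x))\<^sup>2) (at_right 0)"
    by (intro tendsto_intros)
  ultimately have "grad f x \<bullet> (y - x) \<le> f y - f x - \<mu> / 2 * (1 - 0) * (norm (y - x))\<^sup>2"
    using tendsto_le[OF trivial_limit_at_right_real _ grad_directional_tendsto[OF df]] by blast
  then show ?thesis by simp
qed

lemma grad_strongly_monotone:
  assumes sc: "epi_convex \<mu> (\<lambda>x. ereal (f x))" and df: "\<And>x. f differentiable (at x)"
  shows "\<mu> * (norm (x - y))\<^sup>2 \<le> (grad f x - grad f y) \<bullet> (x - y)"
proof -
  have 1: "f x + grad f x \<bullet> (y - x) + \<mu> / 2 * (norm (y - x))\<^sup>2 \<le> f y"
    and 2: "f y + grad f y \<bullet> (x - y) + \<mu> / 2 * (norm (x - y))\<^sup>2 \<le> f x"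
    by (rule strongly_convex_gradient_ineq[OF sc df])+
  have "grad f x \<bullet> (y - x) = - (grad f x \<bullet> (x - y))" by (simp add: algebra_simps)
  with 1 2 show ?thesis by (simp add: norm_minus_commute inner_diff_left)
qed

text \<open>Expanding the square, strong monotonicity controls the cross term and the Lipschitz
  constant the last term. For \<mu> = 0 the factor is sqrt (1 + c^2 \<beta>^2), so the step alone
  need not be a contraction.\<close>

lemma gradient_step_norm_le:
  assumes sc: "epi_convex \<mu> (\<lambda>x. ereal (f x))" and df: "\<And>x. f differentiable (at x)"
    and lip: "\<beta>-lipschitz_on UNIV (grad f)" and c: "0 \<le> c"
  shows "norm ((x - c *\<^sub>R grad f x) - (y - c *\<^sub>R grad f y)) \<le> sqrt (1 - 2 * c * \<mu> + c\<^sup>2 * \<beta>\<^sup>2) * norm (x - y)"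
proof -
  define d D where "d = x - y" and "D = grad f x - grad f y"
  have mon: "\<mu> * (norm d)\<^sup>2 \<le> D \<bullet> d"
    unfolding d_def D_def by (rule grad_strongly_monotone[OF sc df])
  have "norm D \<le> \<beta> * norm d"
    using lipschitz_onD[OF lip, of x y] by (simp add: d_def D_def dist_norm)
  then have "(norm D)\<^sup>2 \<le> \<beta>\<^sup>2 * (norm d)\<^sup>2"
    by (metis norm_ge_zero power_mono power_mult_distrib)
  then have D2: "c\<^sup>2 * (norm D)\<^sup>2 \<le> c\<^sup>2 * (\<beta>\<^sup>2 * (norm d)\<^sup>2)" by (rule mult_left_mono) simp
  have "(norm (d - c *\<^sub>R D))\<^sup>2 = (norm d)\<^sup>2 - 2 * c * (D \<bullet> d) + c\<^sup>2 * (norm D)\<^sup>2"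
    unfolding power2_norm_eq_inner by (simp add: algebra_simps inner_commute power2_eq_square)
  also have "\<dots> \<le> (norm d)\<^sup>2 - 2 * c * (\<mu> * (norm d)\<^sup>2) + c\<^sup>2 * (\<beta>\<^sup>2 * (norm d)\<^sup>2)"
    using mult_left_mono[OF mon, of "2 * c"] c D2 by linarith
  also have "\<dots> = (1 - 2 * c * \<mu> + c\<^sup>2 * \<beta>\<^sup>2) * (norm d)\<^sup>2" by (simp add: algebra_simps)
  finally have "norm (d - c *\<^sub>R D) \<le> sqrt ((1 - 2 * c * \<mu> + c\<^sup>2 * \<beta>\<^sup>2) * (norm d)\<^sup>2)"
    by (rule real_le_rsqrt)
  moreover have "(x - c *\<^sub>R grad f x) - (y - c *\<^sub>R grad f y) = d - c *\<^sub>R D"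
    by (simp add: d_def D_def algebra_simps)
  ultimately show ?thesis by (simp only: real_sqrt_mult real_sqrt_abs abs_norm_cancel d_def)
qed

text \<open>This is the optimality condition that minus the gradient of \<open>f\<close> is a
  subgradient of \<open>g\<close> at \<open>x\<close>, written without subdifferentials. It comes
  from comparing \<open>x\<close> with x + t (v - x), bounding the change of \<open>g\<close> by
  convexity, and dividing by t.\<close>

lemma minimizer_sum_variational_ineq:
  assumes cg: "epi_convex 0 g" and df: "f differentiable (at x)"
    and mn: "is_minimizer (\<lambda>y. ereal (f y) + g y) x"
    and a: "g x = ereal a" and b: "g v \<le> ereal b"
  shows "a - grad f x \<bullet> (v - x) \<le> b"
proof -
  have "a - b \<le> (f (x + t *\<^sub>R (v - x)) - f x) / t" if t: "0 < t" "t < 1" for t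
  proof -
    have eq: "x + t *\<^sub>R (v - x) = t *\<^sub>R v + (1 - t) *\<^sub>R x" by (simp add: algebra_simps)
    have "ereal (f x) + ereal a \<le> ereal (f (x + t *\<^sub>R (v - x))) + g (t *\<^sub>R v + (1 - t) *\<^sub>R x)"
      using mn unfolding is_minimizer_def a[symmetric] eq by blast
    also have "\<dots> \<le> ereal (f (x + t *\<^sub>R (v - x))) + ereal (t * b + (1 - t) * a - 0 / 2 * t * (1 - t) * (norm (v - x))\<^sup>2)"
      using t a b by (intro add_left_mono epi_convexD[OF cg]) auto
    finally have "t * (a - b) \<le> f (x + t *\<^sub>R (v - x)) - f x" by (simp add: algebra_simps)
    then show ?thesis using t by (simp add: pos_le_divide_eq mult.commute)
  qed
  then have "\<forall>\<^sub>F t in at_right 0. a - b \<le> (f (x + t *\<^sub>R (v - x)) - f x) / t"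
    unfolding eventually_at_right_field by (intro exI[of _ 1]) auto
  then have "a - b \<le> grad f x \<bullet> (v - x)"
    using tendsto_lowerbound[OF grad_directional_tendsto[OF df]] trivial_limit_at_right_real by blast
  then show ?thesis by simp
qed

text \<open>Expanding the squared distance from the shifted point to \<open>v\<close> around
  \<open>x\<close> produces exactly the linear term of the variational inequality, plus a
  nonnegative square. Hence \<open>x\<close> minimizes the proximal objective at the shifted
  point.\<close>

lemma minimizer_sum_prox_fixed_point:
  assumes cg: "epi_convex 0 g" and clg: "ext_closed g" and prg: "ext_proper g"
    and df: "f differentiable (at x)" and c: "0 < c"
    and mn: "is_minimizer (\<lambda>y. ereal (f y) + g y) x"
  shows "prox (\<lambda>u. ereal c * g u) (x - c *\<^sub>R grad f x) = x"
proof (rule prox_eqI[OF epi_convex_cmult[OF cg c] _ ext_closed_cmult[OF clg c] ext_proper_cmult[OF prg c]])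
  have "ext_proper (\<lambda>y. ereal (f y) + g y)"
    using ext_proper_add_real[OF prg, of f] by (simp add: add.commute)
  then obtain a where "ereal (f x) + g x = ereal a" using mn by (rule is_minimizer_finite)
  then obtain a where a: "g x = ereal a" by (cases "g x") auto
  let ?z = "x - c *\<^sub>R grad f x"
  show "is_minimizer (\<lambda>u. ereal c * g u + ereal ((norm (?z - u))\<^sup>2 / 2)) x"
    unfolding is_minimizer_def
  proof
    fix v
    show "ereal c * g x + ereal ((norm (?z - x))\<^sup>2 / 2) \<le> ereal c * g v + ereal ((norm (?z - v))\<^sup>2 / 2)"
    proof (cases "g v")
      case (real b)
      have "a - grad f x \<bullet> (v - x) \<le> b"
        by (rule minimizer_sum_variational_ineq[OF cg df mn a]) (simp add: real)
      then have "c * (a - grad f x \<bullet> (v - x)) \<le> c * b" using c by simp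
      moreover have "(norm (?z - v))\<^sup>2 = (norm (?z - x))\<^sup>2 + 2 * c * (grad f x \<bullet> (v - x)) + (norm (v - x))\<^sup>2"
        unfolding power2_norm_eq_inner by (simp add: algebra_simps inner_commute)
      moreover have "(norm (v - x))\<^sup>2 \<ge> 0" by simp
      ultimately have "c * a + (norm (?z - x))\<^sup>2 / 2 \<le> c * b + (norm (?z - v))\<^sup>2 / 2"
        unfolding right_diff_distrib[of c a] by linarith
      then show ?thesis using real a by simp
    next
      case PInf then show ?thesis using c by simp
    next
      case MInf then show ?thesis using prg unfolding ext_proper_def by auto
    qed
  qed
qed (use c in auto)

section \<open>Absolutely continuous curves and locally Lipschitz maps\<close>

text \<open>A value \<open>y\<close> of \<open>g t = \<phi> t - (C + \<epsilon>) t\<close> that is not attained on the null set exists since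
  Lipschitz maps preserve null sets; at the last time where \<open>g \<le> y\<close> the derivative of \<open>g\<close> cannot be
  negative.\<close>
lemma lipschitz_ae_deriv_le_imp_increment_le:
  fixes \<phi> :: "real \<Rightarrow> real"
  assumes lip: "L-lipschitz_on {a..b} \<phi>" and ab: "a \<le> b" and N: "N \<in> null_sets lebesgue"
    and der: "\<And>t. t \<in> {a<..<b} - N \<Longrightarrow> \<exists>d\<le>C. (\<phi> has_real_derivative d) (at t)"
  shows "\<phi> b - \<phi> a \<le> C * (b - a)"
proof (rule ccontr)
  assume "\<not> ?thesis"
  then have gt: "\<phi> b - \<phi> a > C * (b - a)" by simp
  then have ab': "a < b" using ab by (cases "a = b") auto
  \<comment> \<open>Half of the excess slope: \<open>g\<close> still increases from \<open>a\<close>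
    to \<open>b\<close>, while its derivative off \<open>N\<close> is at most -e.\<close>
  define e where "e = (\<phi> b - \<phi> a - C * (b - a)) / (2 * (b - a))"
  have e: "e > 0" and e2: "2 * e * (b - a) = \<phi> b - \<phi> a - C * (b - a)"
    unfolding e_def using gt ab' by (auto simp: field_simps)
  define g where "g = (\<lambda>t. \<phi> t - (C + e) * t)"
  have "g b - g a = e * (b - a)" unfolding g_def using e2 by (simp add: algebra_simps)
  then have gab: "g a < g b" using e ab' by (smt (verit) mult_pos_pos)
  have g_lip: "\<bar>g x - g y\<bar> \<le> (L + \<bar>C + e\<bar>) * \<bar>x - y\<bar>" if "x \<in> {a..b}" "y \<in> {a..b}" for x y
  proof -
    have "\<bar>\<phi> x - \<phi> y\<bar> \<le> L * \<bar>x - y\<bar>" using lipschitz_onD[OF lip that] by (simp add: dist_real_def)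
    moreover have "\<bar>(C + e) * x - (C + e) * y\<bar> = \<bar>C + e\<bar> * \<bar>x - y\<bar>"
      by (metis abs_mult right_diff_distrib)
    ultimately show ?thesis unfolding g_def by (simp add: distrib_right)
  qed
  have g_cont: "continuous_on {a..b} g"
    unfolding g_def by (intro continuous_intros lipschitz_on_continuous_on[OF lip])
  have "negligible (g ` (N \<inter> {a..b}))"
  proof (rule negligible_locally_Lipschitz_image)
    show "negligible (N \<inter> {a..b})"
      using N by (intro negligible_Int disjI1) (simp add: negligible_iff_null_sets)
    fix x assume x: "x \<in> N \<inter> {a..b}"
    show "\<exists>T B. open T \<and> x \<in> T \<and> (\<forall>y\<in>N \<inter> {a..b} \<inter> T. norm (g y - g x) \<le> B * norm (y - x))"
      using x g_lip by (intro exI[of _ UNIV] exI[of _ "L + \<bar>C + e\<bar>"]) auto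
  qed simp
  moreover have "\<not> negligible {g a<..<g b}"
    using gab by (intro open_not_negligible) auto
  ultimately obtain y where y: "g a < y" "y < g b" "y \<notin> g ` (N \<inter> {a..b})"
    using negligible_subset by (metis greaterThanLessThan_iff subsetI)
  let ?S = "{t \<in> {a..b}. g t \<le> y}"
  have "closed ?S" by (intro continuous_on_closed_Collect_le g_cont continuous_on_const closed_atLeastAtMost)
  moreover have "bounded ?S" by (rule bounded_subset[of "{a..b}"]) auto
  ultimately have "compact ?S" by (simp add: compact_eq_bounded_closed)
  moreover have "a \<in> ?S" using ab y by auto
  ultimately obtain s where s: "s \<in> ?S" "\<And>t. t \<in> ?S \<Longrightarrow> t \<le> s"
    using compact_attains_sup[of ?S] by blast
  have "s \<noteq> b" using s y by auto
  then have sb: "s < b" using s by auto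
  have gs: "g s = y"
  proof (rule ccontr)
    assume "g s \<noteq> y"
    then have "g s < y" using s by auto
    moreover have "continuous_on {s..b} g" using s by (intro continuous_on_subset[OF g_cont]) auto
    ultimately obtain t where "s \<le> t" "t \<le> b" "g t = y" using IVT'[of g s y b] y sb by auto
    then show False using s \<open>g s < y\<close> by (metis (mono_tags, lifting) atLeastAtMost_iff
          le_less less_irrefl mem_Collect_eq order_trans not_le)
  qed
  have "s \<noteq> a" using gs y by auto
  then have "s \<in> {a<..<b} - N" using s sb gs y by auto
  then obtain d where d: "d \<le> C" "(\<phi> has_real_derivative d) (at s)" using der by blast
  have "(g has_real_derivative d - (C + e)) (at s)"
    unfolding g_def by (auto intro!: derivative_eq_intros d)
  moreover have "d - (C + e) < 0" using d e by simp
  ultimately obtain \<delta> where \<delta>: "\<delta> > 0" "\<And>h. 0 < h \<Longrightarrow> h < \<delta> \<Longrightarrow> g (s + h) < g s"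
    using DERIV_neg_dec_right by blast
  define h where "h = min (\<delta> / 2) (b - s)"
  have h: "0 < h" "h < \<delta>" "s + h \<le> b" unfolding h_def using \<delta> sb by auto
  then have "s + h \<in> ?S" using \<delta>(2)[of h] gs s(1) by auto
  then show False using s(2)[of "s + h"] h by simp
qed

lemma locally_lipschitz_on_compact_imp_lipschitz:
  assumes F: "locally_lipschitz_on S F" and K: "compact K" "K \<subseteq> S"
  shows "\<exists>L. L-lipschitz_on K F"
proof -
  \<comment> \<open>\<open>local_lipschitz\<close> is a notion for time-dependent maps; a one-point
    time set reduces it to the present one.\<close>
  have "local_lipschitz {0::real} K (\<lambda>_. F)"
    unfolding local_lipschitz_def
  proof (intro ballI)
    fix x t assume x: "x \<in> K"
    then obtain e L where e: "e > 0" "L-lipschitz_on (ball x e \<inter> S) F"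
      using F K unfolding locally_lipschitz_on_def by blast
    have "L-lipschitz_on (cball x (e/2) \<inter> K) F"
      using K e by (intro lipschitz_on_subset[OF e(2)]) auto
    then show "\<exists>u>0. \<exists>L. \<forall>t\<in>cball t u \<inter> {0}. L-lipschitz_on (cball x u \<inter> K) F"
      using e by (intro exI[of _ "e/2"]) auto
  qed
  then show ?thesis
    by (rule local_lipschitz_compact_implies_lipschitz[OF _ K(1)]) auto
qed

section \<open>Absolutely continuous curves\<close>

lemma abs_cont_onE:
  assumes "abs_cont_on a b c" "e > 0"
  obtains d where "d > 0" and "\<forall>(I::nat \<Rightarrow> real \<times> real) k.
        (\<forall>i<k. a \<le> fst (I i) \<and> fst (I i) \<le> snd (I i) \<and> snd (I i) \<le> b) \<and>
        (\<forall>i<k. \<forall>j<k. i \<noteq> j \<longrightarrow> snd (I i) \<le> fst (I j) \<or> snd (I j) \<le> fst (I i)) \<and>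
        (\<Sum>i<k. snd (I i) - fst (I i)) < d
        \<longrightarrow> (\<Sum>i<k. norm (c (snd (I i)) - c (fst (I i)))) < e"
  using assms(1)[unfolded abs_cont_on_def, rule_format, OF assms(2)] by (elim exE conjE) (rule that)

lemma abs_cont_on_id: "abs_cont_on a b (\<lambda>t. t)"
  unfolding abs_cont_on_def
proof (intro allI impI)
  fix e :: real assume e: "e > 0"
  show "\<exists>d>0. \<forall>(I::nat \<Rightarrow> real \<times> real) k.
        (\<forall>i<k. a \<le> fst (I i) \<and> fst (I i) \<le> snd (I i) \<and> snd (I i) \<le> b) \<and>
        (\<forall>i<k. \<forall>j<k. i \<noteq> j \<longrightarrow> snd (I i) \<le> fst (I j) \<or> snd (I j) \<le> fst (I i)) \<and>
        (\<Sum>i<k. snd (I i) - fst (I i)) < d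
        \<longrightarrow> (\<Sum>i<k. norm (snd (I i) - fst (I i))) < e"
  proof (intro exI[of _ e] conjI allI impI, rule e)
    fix I :: "nat \<Rightarrow> real \<times> real" and k
    assume A: "(\<forall>i<k. a \<le> fst (I i) \<and> fst (I i) \<le> snd (I i) \<and> snd (I i) \<le> b) \<and>
        (\<forall>i<k. \<forall>j<k. i \<noteq> j \<longrightarrow> snd (I i) \<le> fst (I j) \<or> snd (I j) \<le> fst (I i)) \<and>
        (\<Sum>i<k. snd (I i) - fst (I i)) < e"
    have "(\<Sum>i<k. norm (snd (I i) - fst (I i))) = (\<Sum>i<k. snd (I i) - fst (I i))"
      using A by (intro sum.cong) auto
    then show "(\<Sum>i<k. norm (snd (I i) - fst (I i))) < e" using A by simp
  qed
qed

lemma abs_cont_on_lipschitz_compose: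
  assumes c: "abs_cont_on a b c" and F: "L-lipschitz_on (c ` {a..b}) F"
  shows "abs_cont_on a b (F \<circ> c)"
  unfolding abs_cont_on_def
proof (intro allI impI)
  fix e :: real assume e: "e > 0"
  have L: "L \<ge> 0" using F lipschitz_on_nonneg by blast
  then have eL: "e / (L + 1) > 0" using e by simp
  obtain d where d: "d > 0" and *: "\<forall>(I::nat \<Rightarrow> real \<times> real) k.
        (\<forall>i<k. a \<le> fst (I i) \<and> fst (I i) \<le> snd (I i) \<and> snd (I i) \<le> b) \<and>
        (\<forall>i<k. \<forall>j<k. i \<noteq> j \<longrightarrow> snd (I i) \<le> fst (I j) \<or> snd (I j) \<le> fst (I i)) \<and>
        (\<Sum>i<k. snd (I i) - fst (I i)) < d
        \<longrightarrow> (\<Sum>i<k. norm (c (snd (I i)) - c (fst (I i)))) < e / (L + 1)"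
    by (rule abs_cont_onE[OF c eL])
  show "\<exists>d>0. \<forall>(I::nat \<Rightarrow> real \<times> real) k.
        (\<forall>i<k. a \<le> fst (I i) \<and> fst (I i) \<le> snd (I i) \<and> snd (I i) \<le> b) \<and>
        (\<forall>i<k. \<forall>j<k. i \<noteq> j \<longrightarrow> snd (I i) \<le> fst (I j) \<or> snd (I j) \<le> fst (I i)) \<and>
        (\<Sum>i<k. snd (I i) - fst (I i)) < d
        \<longrightarrow> (\<Sum>i<k. norm ((F \<circ> c) (snd (I i)) - (F \<circ> c) (fst (I i)))) < e"
  proof (intro exI[of _ d] conjI allI impI, rule d)
    fix I :: "nat \<Rightarrow> real \<times> real" and k
    assume A: "(\<forall>i<k. a \<le> fst (I i) \<and> fst (I i) \<le> snd (I i) \<and> snd (I i) \<le> b) \<and>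
        (\<forall>i<k. \<forall>j<k. i \<noteq> j \<longrightarrow> snd (I i) \<le> fst (I j) \<or> snd (I j) \<le> fst (I i)) \<and>
        (\<Sum>i<k. snd (I i) - fst (I i)) < d"
    have "(\<Sum>i<k. norm ((F \<circ> c) (snd (I i)) - (F \<circ> c) (fst (I i))))
        \<le> (\<Sum>i<k. (L + 1) * norm (c (snd (I i)) - c (fst (I i))))"
    proof (rule sum_mono)
      fix i assume "i \<in> {..<k}"
      then have "c (snd (I i)) \<in> c ` {a..b}" "c (fst (I i)) \<in> c ` {a..b}"
        using A by (auto intro!: imageI)
      then have "norm ((F \<circ> c) (snd (I i)) - (F \<circ> c) (fst (I i))) \<le> L * norm (c (snd (I i)) - c (fst (I i)))"
        using lipschitz_onD[OF F] by (simp add: dist_norm)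
      also have "\<dots> \<le> (L + 1) * norm (c (snd (I i)) - c (fst (I i)))"
        by (intro mult_right_mono) auto
      finally show "norm ((F \<circ> c) (snd (I i)) - (F \<circ> c) (fst (I i))) \<le> (L + 1) * norm (c (snd (I i)) - c (fst (I i)))" .
    qed
    also have "\<dots> = (L + 1) * (\<Sum>i<k. norm (c (snd (I i)) - c (fst (I i))))"
      by (simp add: sum_distrib_left)
    also have "\<dots> < (L + 1) * (e / (L + 1))"
      using L by (intro mult_strict_left_mono mp[OF spec[OF spec[OF *]] A]) auto
    finally show "(\<Sum>i<k. norm ((F \<circ> c) (snd (I i)) - (F \<circ> c) (fst (I i)))) < e" using L by simp
  qed
qed

lemma abs_cont_on_imp_continuous_on:
  assumes "abs_cont_on a b c"
  shows "continuous_on {a..b} c"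
  unfolding continuous_on_iff
proof (intro ballI allI impI)
  fix x e :: real assume x: "x \<in> {a..b}" and e: "0 < e"
  obtain d where d: "d > 0" and *: "\<forall>(I::nat \<Rightarrow> real \<times> real) k.
        (\<forall>i<k. a \<le> fst (I i) \<and> fst (I i) \<le> snd (I i) \<and> snd (I i) \<le> b) \<and>
        (\<forall>i<k. \<forall>j<k. i \<noteq> j \<longrightarrow> snd (I i) \<le> fst (I j) \<or> snd (I j) \<le> fst (I i)) \<and>
        (\<Sum>i<k. snd (I i) - fst (I i)) < d
        \<longrightarrow> (\<Sum>i<k. norm (c (snd (I i)) - c (fst (I i)))) < e"
    by (rule abs_cont_onE[OF assms e])
  \<comment> \<open>The family consists of the single interval between \<open>x\<close> and
    \<open>y\<close>.\<close>
  have "dist (c y) (c x) < e" if y: "y \<in> {a..b}" "dist y x < d" for y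
    using *[THEN spec[of _ "\<lambda>_. (min x y, max x y)"], THEN spec[of _ 1]] x y
    by (cases "x \<le> y") (auto simp: min_def max_def dist_norm norm_minus_commute)
  then show "\<exists>d>0. \<forall>x'\<in>{a..b}. dist x' x < d \<longrightarrow> dist (c x') (c x) < e" using d by blast
qed

lemma abs_cont_on_locally_lipschitz_compose:
  assumes c: "abs_cont_on a b c" "c ` {a..b} \<subseteq> S" and F: "locally_lipschitz_on S F"
  shows "abs_cont_on a b (F \<circ> c)"
proof -
  have "compact (c ` {a..b})"
    using abs_cont_on_imp_continuous_on[OF c(1)] compact_continuous_image compact_Icc by blast
  then obtain L where "L-lipschitz_on (c ` {a..b}) F"
    using locally_lipschitz_on_compact_imp_lipschitz[OF F _ c(2)] by blast
  with c(1) show ?thesis by (rule abs_cont_on_lipschitz_compose)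
qed

lemma abs_cont_on_line: "abs_cont_on a b (\<lambda>t. z + t *\<^sub>R (v :: 'a::real_normed_vector))"
proof -
  have "(norm v)-lipschitz_on ((\<lambda>t. t) ` {a..b}) (\<lambda>t. z + t *\<^sub>R v)"
    by (intro lipschitz_onI) (auto simp: dist_norm scaleR_diff_left[symmetric])
  from abs_cont_on_lipschitz_compose[OF abs_cont_on_id this] show ?thesis by (simp add: o_def)
qed

lemma closed_graph_iff_sequential:
  fixes S :: "'a::metric_space set" and J :: "'a \<Rightarrow> 'b::metric_space set"
  shows "closedin (top_of_set (S \<times> UNIV)) (SIGMA z:S. J z) \<longleftrightarrow>
     (\<forall>zs z Ms M. (\<forall>n::nat. zs n \<in> S) \<longrightarrow> z \<in> S \<longrightarrow> zs \<longlonglongrightarrow> z \<longrightarrow> (\<forall>n. Ms n \<in> J (zs n)) \<longrightarrow> Ms \<longlonglongrightarrow> M \<longrightarrow> M \<in> J z)"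
  (is "?L \<longleftrightarrow> ?R")
proof
  assume L: ?L
  show ?R
  proof (intro allI impI)
    fix zs :: "nat \<Rightarrow> 'a" and z Ms M
    assume A: "\<forall>n. zs n \<in> S" "z \<in> S" "zs \<longlonglongrightarrow> z" "\<forall>n. Ms n \<in> J (zs n)" "Ms \<longlonglongrightarrow> M"
    obtain C where C: "closed C" "(SIGMA z:S. J z) = S \<times> UNIV \<inter> C"
      using L unfolding closedin_closed by blast
    have "(\<lambda>n. (zs n, Ms n)) \<longlonglongrightarrow> (z, M)" using A by (intro tendsto_Pair)
    moreover have "(zs n, Ms n) \<in> C" for n
    proof -
      have "(zs n, Ms n) \<in> (SIGMA z:S. J z)" using A by auto
      then show ?thesis unfolding C(2) by simp
    qed
    ultimately have "(z, M) \<in> C" by (rule closed_sequentially[OF C(1), rotated])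
    then have "(z, M) \<in> (SIGMA z:S. J z)" unfolding C(2) using A by simp
    then show "M \<in> J z" by simp
  qed
next
  assume R: ?R
  have "(SIGMA z:S. J z) = S \<times> UNIV \<inter> closure (SIGMA z:S. J z)"
  proof (intro equalityI subsetI)
    fix p assume "p \<in> S \<times> UNIV \<inter> closure (SIGMA z:S. J z)"
    then have p: "fst p \<in> S" and "p \<in> closure (SIGMA z:S. J z)" by auto
    then obtain X where X: "\<And>n. X n \<in> (SIGMA z:S. J z)" "X \<longlonglongrightarrow> p"
      unfolding closure_sequential by metis
    have 1: "\<forall>n. fst (X n) \<in> S" "\<forall>n. snd (X n) \<in> J (fst (X n))"
      using X(1) by (auto simp: Sigma_def) (metis fst_conv, metis fst_conv snd_conv)
    have "snd p \<in> J (fst p)"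
      using R[rule_format, of "\<lambda>n. fst (X n)" "fst p" "\<lambda>n. snd (X n)" "snd p"] 1 p
        tendsto_fst[OF X(2)] tendsto_snd[OF X(2)] by blast
    then show "p \<in> (SIGMA z:S. J z)" using p by (cases p) auto
  qed (use closure_subset[of "SIGMA z:S. J z"] in auto)
  then show ?L unfolding closedin_closed by (intro exI[of _ "closure (SIGMA z:S. J z)"]) auto
qed

section \<open>Matrix norms and bounds on derivatives from increments\<close>

lemma norm_matrix_vector_mult_le:
  fixes A :: "real^'n^'m"
  shows "norm (A *v x) \<le> norm A * norm x"
proof -
  have "norm (A *v x) = L2_set (\<lambda>i. norm ((A *v x) $ i)) UNIV" by (simp add: norm_vec_def)
  also have "\<dots> \<le> L2_set (\<lambda>i. norm (A $ i) * norm x) UNIV"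
    by (intro L2_set_mono) (auto simp: matrix_vector_mul_component intro: Cauchy_Schwarz_ineq2)
  also have "\<dots> = norm A * norm x"
    unfolding norm_vec_def[of A] by (simp add: L2_set_left_distrib)
  finally show ?thesis .
qed

lemma bounded_operator_norm_le:
  "bounded {M :: real^'n^'m. \<forall>h. norm (M *v h) \<le> L * norm h}"
proof (rule boundedI)
  fix M :: "real^'n^'m" assume M: "M \<in> {M. \<forall>h. norm (M *v h) \<le> L * norm h}"
  have "\<bar>M $ i $ j\<bar> \<le> \<bar>L\<bar>" for i j
  proof -
    have "M $ i $ j = (M *v axis j 1) $ i" by (simp add: matrix_vector_mult_basis column_def)
    also have "\<bar>\<dots>\<bar> \<le> norm (M *v axis j 1)" by (rule component_le_norm_cart)
    also have "\<dots> \<le> L * norm (axis j 1 :: real^'n)" using M by blast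
    finally show ?thesis by (simp add: abs_if split: if_splits)
  qed
  then have "norm (M $ i) \<le> (\<Sum>j\<in>(UNIV::'n set). \<bar>L\<bar>)" for i
    by (intro order_trans[OF norm_le_l1_cart] sum_mono)
  then have "(\<Sum>i\<in>UNIV. norm (M $ i)) \<le> (\<Sum>i\<in>(UNIV::'m set). \<Sum>j\<in>(UNIV::'n set). \<bar>L\<bar>)"
    by (intro sum_mono)
  moreover have "norm M \<le> (\<Sum>i\<in>UNIV. norm (M $ i))"
    by (simp add: norm_vec_def[of M] L2_set_le_sum)
  ultimately show "norm M \<le> (\<Sum>i\<in>(UNIV::'m set). \<Sum>j\<in>(UNIV::'n set). \<bar>L\<bar>)" by linarith
qed

lemma tendsto_matrix_vector_mult:
  fixes A :: "'b \<Rightarrow> real^'n^'m"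
  assumes "(A \<longlongrightarrow> A0) F" "(x \<longlongrightarrow> x0) F"
  shows "((\<lambda>k. A k *v x k) \<longlongrightarrow> A0 *v x0) F"
  unfolding matrix_vector_mult_def
  by (intro vec_tendstoI) (auto intro!: tendsto_intros assms)

lemma continuous_on_matrix_vector_mult_left: "continuous_on S (\<lambda>M :: real^'n^'m. M *v h)"
  unfolding continuous_on_def by (intro ballI tendsto_matrix_vector_mult tendsto_const tendsto_ident_at)

text \<open>The derivative in direction \<open>h\<close> is a limit of difference quotients from the
  right, so a bound on increments along a short ray suffices. Pairing with \<open>w\<close> gives a
  scalar inequality, the form in which conservative Jacobians supply bounds.\<close>

lemma has_derivative_inner_le:
  fixes F :: "'a::real_normed_vector \<Rightarrow> 'b::real_inner"
  assumes der: "(F has_derivative D) (at z)" and e: "e > 0"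
    and le: "\<And>t. 0 < t \<Longrightarrow> t < e \<Longrightarrow> w \<bullet> (F (z + t *\<^sub>R h) - F z) \<le> t * C"
  shows "w \<bullet> D h \<le> C"
proof -
  have "((\<lambda>t. z + t *\<^sub>R h) has_derivative (\<lambda>t. t *\<^sub>R h)) (at (0::real))"
    by (auto intro!: derivative_eq_intros)
  moreover have "((\<lambda>y. w \<bullet> F y) has_derivative (\<lambda>y. w \<bullet> D y)) (at (z + 0 *\<^sub>R h))"
    using has_derivative_inner_right[OF der] by simp
  ultimately have "((\<lambda>y. w \<bullet> F y) \<circ> (\<lambda>t. z + t *\<^sub>R h) has_derivative (\<lambda>y. w \<bullet> D y) \<circ> (\<lambda>t. t *\<^sub>R h)) (at 0)"
    by (rule diff_chain_at)
  moreover have "D (t *\<^sub>R h) = t *\<^sub>R D h" for t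
    using has_derivative_bounded_linear[OF der] by (simp add: bounded_linear.linear linear_scale)
  ultimately have "((\<lambda>t. w \<bullet> F (z + t *\<^sub>R h)) has_real_derivative w \<bullet> D h) (at 0)"
    by (simp add: has_field_derivative_def o_def mult.commute[of _ "w \<bullet> D h"])
  then have "((\<lambda>t. (w \<bullet> F (z + t *\<^sub>R h) - w \<bullet> F z) / t) \<longlongrightarrow> w \<bullet> D h) (at 0)"
    by (simp add: DERIV_def)
  then have "((\<lambda>t. (w \<bullet> F (z + t *\<^sub>R h) - w \<bullet> F z) / t) \<longlongrightarrow> w \<bullet> D h) (at_right 0)"
    by (rule filterlim_mono) (auto simp: at_within_le_at)
  moreover have "\<forall>\<^sub>F t in at_right 0. (w \<bullet> F (z + t *\<^sub>R h) - w \<bullet> F z) / t \<le> C"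
    unfolding eventually_at_right_field using e le
    by (intro exI[of _ e]) (auto simp: pos_divide_le_eq inner_diff_right mult.commute)
  ultimately show ?thesis using tendsto_upperbound trivial_limit_at_right_real by blast
qed

text \<open>Pairing the increments with the vector \<open>D h\<close> itself turns the scalar bound
  into a norm bound.\<close>

lemma has_derivative_norm_le_lipschitz:
  fixes F :: "'a::real_normed_vector \<Rightarrow> 'b::real_inner"
  assumes der: "(F has_derivative D) (at z)" and e: "e > 0"
    and lip: "\<And>t. 0 < t \<Longrightarrow> t < e \<Longrightarrow> norm (F (z + t *\<^sub>R h) - F z) \<le> L * norm (t *\<^sub>R h)"
  shows "norm (D h) \<le> L * norm h"
proof -
  have "D h \<bullet> D h \<le> norm (D h) * (L * norm h)"
  proof (rule has_derivative_inner_le[OF der e])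
    fix t :: real assume t: "0 < t" "t < e"
    have "D h \<bullet> (F (z + t *\<^sub>R h) - F z) \<le> norm (D h) * norm (F (z + t *\<^sub>R h) - F z)"
      by (rule norm_cauchy_schwarz)
    also have "\<dots> \<le> norm (D h) * (L * norm (t *\<^sub>R h))" by (intro mult_left_mono lip t) simp
    finally show "D h \<bullet> (F (z + t *\<^sub>R h) - F z) \<le> t * (norm (D h) * (L * norm h))"
      using t by (simp add: mult_ac)
  qed
  then have "norm (D h) * norm (D h) \<le> norm (D h) * (L * norm h)"
    by (simp add: dot_square_norm power2_eq_square)
  moreover have "0 \<le> L * norm h"
    using order_trans[OF norm_ge_zero lip[of "e / 2"]] e by (simp add: zero_le_mult_iff mult_le_0_iff)
  ultimately show ?thesis by (cases "D h = 0") auto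
qed

section \<open>Clarke Jacobians of path differentiable maps\<close>

text \<open>Closedness absorbs limits of derivatives and convexity absorbs the hull. Every estimate
  on Clarke Jacobians below is an instance: operator norm bounds, half-spaces, contraction bounds,
  and bounds on w \<bullet> (M *v v).\<close>

lemma clarke_jac_subset:
  assumes P: "closed P" "convex P" and e: "e > 0"
    and der: "\<And>z' M. z' \<in> ball z e \<Longrightarrow> (F has_derivative (\<lambda>h. M *v h)) (at z') \<Longrightarrow> M \<in> P"
  shows "clarke_jac F z \<subseteq> P"
  unfolding clarke_jac_def
proof (rule hull_minimal)
  show "{M. \<exists>zs Ms. zs \<longlonglongrightarrow> z \<and> (\<forall>k. (F has_derivative (*v) (Ms k)) (at (zs k))) \<and> Ms \<longlonglongrightarrow> M} \<subseteq> P"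
  proof clarify
    fix M zs Ms assume zs: "zs \<longlonglongrightarrow> z" and d: "\<forall>k. (F has_derivative (*v) (Ms k)) (at (zs k))" and Ms: "Ms \<longlonglongrightarrow> M"
    have "\<forall>\<^sub>F k in sequentially. zs k \<in> ball z e"
      using zs e by (auto simp: tendsto_iff dist_commute)
    then have "\<forall>\<^sub>F k in sequentially. Ms k \<in> P"
      by (rule eventually_mono) (use der d in blast)
    then show "M \<in> P" using Lim_in_closed_set[OF P(1) _ _ Ms] by simp
  qed
qed (rule P)

text \<open>Derivatives inherit the local Lipschitz constant as an operator norm bound. The second
  conclusion, on the derivatives themselves, gives the compactness for the closed graph argument,
  where derivatives rather than elements of the hull subconverge.\<close>

lemma clarke_jac_bounded_near:
  fixes F :: "real^'N \<Rightarrow> real^'m"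
  assumes S: "open S" "z \<in> S" and F: "locally_lipschitz_on S F"
  shows "\<exists>e>0. bounded (\<Union>z'\<in>ball z e. clarke_jac F z') \<and>
           bounded {M. \<exists>z'\<in>ball z e. (F has_derivative (\<lambda>h. M *v h)) (at z')}"
proof -
  obtain e1 L where e1: "e1 > 0" "L-lipschitz_on (ball z e1 \<inter> S) F"
    using F S unfolding locally_lipschitz_on_def by blast
  obtain e2 where e2: "e2 > 0" "ball z e2 \<subseteq> S" using S openE by blast
  define e where "e = min e1 e2"
  have "ball z e \<subseteq> ball z e1 \<inter> S" using e2 by (auto simp: e_def)
  then have lip: "L-lipschitz_on (ball z e) F" by (rule lipschitz_on_subset[OF e1(2)])
  have e: "e > 0" using e1 e2 by (simp add: e_def)
  let ?P = "{M :: real^'N^'m. \<forall>h. norm (M *v h) \<le> L * norm h}"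
  have der: "M \<in> ?P" if z': "z' \<in> ball z e" and d: "(F has_derivative (\<lambda>h. M *v h)) (at z')" for z' M
  proof clarify
    fix h
    obtain r where r: "r > 0" "ball z' r \<subseteq> ball z e" using z' openE open_ball by blast
    show "norm (M *v h) \<le> L * norm h"
    \<comment> \<open>The summand 1 covers \<open>h = 0\<close>; for \<open>t\<close> below this
      bound z' + t h stays in the ball of radius \<open>r\<close>.\<close>
    proof (rule has_derivative_norm_le_lipschitz[OF d, of "r / (norm h + 1)"])
      show "0 < r / (norm h + 1)" using r by (simp add: add_nonneg_pos)
      fix t assume t: "0 < t" "t < r / (norm h + 1)"
      have "t * norm h \<le> t * (norm h + 1)" using t by (intro mult_left_mono) auto
      also have "\<dots> < r" using t by (simp add: pos_less_divide_eq add_nonneg_pos)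
      finally have "z' + t *\<^sub>R h \<in> ball z' r" using t by (simp add: dist_norm)
      then have "z' + t *\<^sub>R h \<in> ball z e" using r(2) by blast
      from lipschitz_onD[OF lip this z']
      show "norm (F (z' + t *\<^sub>R h) - F z') \<le> L * norm (t *\<^sub>R h)" by (simp add: dist_norm)
    qed
  qed
  have cv: "convex ?P" "closed ?P"
  proof -
    have "?P = (\<Inter>h. {M. norm (M *v h) \<le> L * norm h})" by auto
    moreover have "convex {M :: real^'N^'m. norm (M *v h) \<le> L * norm h}" for h
    proof -
      have "{M :: real^'N^'m. norm (M *v h) \<le> L * norm h} = (\<lambda>M. M *v h) -` cball 0 (L * norm h)"
        by (auto simp: dist_norm)
      then show ?thesis
        by (simp only:) (intro convex_linear_vimage convex_cball linearI;
            simp add: matrix_vector_mult_add_rdistrib scaleR_matrix_vector_assoc)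
    qed
    moreover have "closed {M :: real^'N^'m. norm (M *v h) \<le> L * norm h}" for h
      by (intro closed_Collect_le continuous_on_norm continuous_on_matrix_vector_mult_left continuous_on_const)
    ultimately show "convex ?P" "closed ?P" by (auto intro!: convex_INT closed_INT)
  qed
  have "clarke_jac F z' \<subseteq> ?P" if z': "z' \<in> ball z e" for z'
  proof -
    obtain r where "r > 0" "ball z' r \<subseteq> ball z e" using z' openE open_ball by blast
    then show ?thesis using der by (intro clarke_jac_subset[OF cv(2,1), of r]) auto
  qed
  then have "bounded (\<Union>z'\<in>ball z e. clarke_jac F z')"
    by (intro bounded_subset[OF bounded_operator_norm_le[of L]]) blast
  moreover have "bounded {M. \<exists>z'\<in>ball z e. (F has_derivative (\<lambda>h. M *v h)) (at z')}"
    using der by (intro bounded_subset[OF bounded_operator_norm_le[of L]]) blast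
  ultimately show ?thesis using e by blast
qed

text \<open>The limiting Jacobians form an intersection of closures, taken over the derivatives in
  balls of radius 1/(n+1). This replaces a diagonal argument.\<close>

lemma closed_limiting_jac:
  "closed {M. \<exists>zs Ms. zs \<longlonglongrightarrow> z \<and> (\<forall>k. (F has_derivative (*v) (Ms k)) (at (zs k))) \<and> Ms \<longlonglongrightarrow> M}"
    (is "closed ?L")
proof -
  have "?L = (\<Inter>n. closure {M. \<exists>z'\<in>ball z (1 / real (Suc n)). (F has_derivative (*v) M) (at z')})"
    (is "_ = (\<Inter>n. closure (?A n))")
  proof (intro equalityI subsetI INT_I)
    fix M n assume "M \<in> ?L"
    then obtain zs Ms where zs: "zs \<longlonglongrightarrow> z" and d: "\<And>k. (F has_derivative (*v) (Ms k)) (at (zs k))" and Ms: "Ms \<longlonglongrightarrow> M"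
      by blast
    have "\<forall>\<^sub>F k in sequentially. dist (zs k) z < 1 / real (Suc n)"
      using zs by (rule tendstoD) simp
    then have "\<forall>\<^sub>F k in sequentially. Ms k \<in> closure (?A n)"
    proof (rule eventually_mono)
      fix k assume "dist (zs k) z < 1 / real (Suc n)"
      then have "Ms k \<in> ?A n" using d[of k] by (auto simp: dist_commute)
      then show "Ms k \<in> closure (?A n)" by (rule subsetD[OF closure_subset])
    qed
    then show "M \<in> closure (?A n)" by (intro Lim_in_closed_set[OF _ _ _ Ms]) auto
  next
    fix M assume M: "M \<in> (\<Inter>n. closure (?A n))"
    have "\<exists>z' M'. z' \<in> ball z (1 / real (Suc n)) \<and> (F has_derivative (*v) M') (at z') \<and> dist M' M < 1 / real (Suc n)" for n
    proof -
      have "M \<in> closure (?A n)" using M by blast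
      then have "\<exists>M'\<in>?A n. dist M' M < 1 / real (Suc n)"
        unfolding closure_approachable by (rule allE[of _ "1 / real (Suc n)"]) simp
      then show ?thesis by blast
    qed
    then obtain zs Ms where *: "\<And>n. zs n \<in> ball z (1 / real (Suc n))" "\<And>n. (F has_derivative (*v) (Ms n)) (at (zs n))"
        "\<And>n. dist (Ms n) M < 1 / real (Suc n)"
      by metis
    have "zs \<longlonglongrightarrow> z"
      by (rule metric_tendsto_imp_tendsto[OF LIMSEQ_inverse_real_of_nat])
        (use *(1) in \<open>auto simp: dist_commute inverse_eq_divide intro!: always_eventually less_imp_le\<close>)
    moreover have "Ms \<longlonglongrightarrow> M"
      by (rule metric_tendsto_imp_tendsto[OF LIMSEQ_inverse_real_of_nat])
        (use *(3) in \<open>auto simp: inverse_eq_divide intro!: always_eventually less_imp_le\<close>)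
    ultimately show "M \<in> ?L" using *(2) by blast
  qed
  then show ?thesis by (simp only:) (intro closed_INT ballI closed_closure)
qed

text \<open>The convex hull of a closed set need not be closed. Here the limiting Jacobians are also
  bounded, and the hull of a compact set in finite dimension is compact.\<close>

lemma closed_clarke_jac:
  assumes "open S" "z \<in> S" "locally_lipschitz_on S F"
  shows "closed (clarke_jac F z)"
proof -
  let ?L = "{M. \<exists>zs Ms. zs \<longlonglongrightarrow> z \<and> (\<forall>k. (F has_derivative (*v) (Ms k)) (at (zs k))) \<and> Ms \<longlonglongrightarrow> M}"
  obtain e where "e > 0" "bounded (\<Union>z'\<in>ball z e. clarke_jac F z')"
    using clarke_jac_bounded_near[OF assms] by blast
  moreover have "z \<in> ball z e" using \<open>e > 0\<close> by simp
  ultimately have "bounded (clarke_jac F z)" by (elim bounded_subset) blast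
  moreover have "?L \<subseteq> clarke_jac F z" unfolding clarke_jac_def by (rule hull_subset)
  ultimately have "bounded ?L" by (rule bounded_subset)
  then have "compact ?L" using closed_limiting_jac by (simp add: compact_eq_bounded_closed)
  then have "compact (convex hull ?L)" by (rule compact_convex_hull)
  then show ?thesis unfolding clarke_jac_def by (rule compact_imp_closed)
qed

text \<open>A hyperplane strictly separating a matrix from the Clarke Jacobian at \<open>z\<close> also bounds the
  derivatives at all nearby points, hence the Clarke Jacobians there.\<close>
lemma clarke_jac_closed_graph:
  fixes F :: "real^'N \<Rightarrow> real^'m"
  assumes S: "open S" "z \<in> S" and F: "locally_lipschitz_on S F"
    and zs: "zs \<longlonglongrightarrow> z" and Ms: "\<And>n::nat. Ms n \<in> clarke_jac F (zs n)" "Ms \<longlonglongrightarrow> M"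
  shows "M \<in> clarke_jac F z"
proof (rule ccontr)
  assume "M \<notin> clarke_jac F z"
  then obtain a b where ab: "a \<bullet> M < b" "\<And>M'. M' \<in> clarke_jac F z \<Longrightarrow> a \<bullet> M' > b"
    using separating_hyperplane_closed_point[OF _ closed_clarke_jac[OF S F], of M]
    unfolding clarke_jac_def using convex_convex_hull by blast
  let ?P = "{M'. a \<bullet> M' \<ge> b}"
  \<comment> \<open>Otherwise derivatives on the wrong side of the hyperplane, at points tending to
    \<open>z\<close>, would subconverge to an element of the Clarke Jacobian at \<open>z\<close>
    that violates the strict separation.\<close>
  have "\<exists>e>0. \<forall>z'\<in>ball z e. \<forall>M'. (F has_derivative (*v) M') (at z') \<longrightarrow> M' \<in> ?P"
  proof (rule ccontr)
    assume "\<not> ?thesis"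
    then have "\<exists>z' M'. z' \<in> ball z (1 / real (Suc n)) \<and> (F has_derivative (*v) M') (at z') \<and> M' \<notin> ?P" for n
      by (metis of_nat_0_less_iff zero_less_Suc zero_less_divide_1_iff)
    then obtain ys Ns where *: "\<And>n. ys n \<in> ball z (1 / real (Suc n))" "\<And>n. (F has_derivative (*v) (Ns n)) (at (ys n))"
        "\<And>n. Ns n \<notin> ?P"
      by metis
    have ys: "ys \<longlonglongrightarrow> z"
      by (rule metric_tendsto_imp_tendsto[OF LIMSEQ_inverse_real_of_nat])
        (use *(1) in \<open>auto simp: dist_commute inverse_eq_divide intro!: always_eventually less_imp_le\<close>)
    obtain e where e: "e > 0" "bounded {M. \<exists>z'\<in>ball z e. (F has_derivative (*v) M) (at z')}"
      using clarke_jac_bounded_near[OF S F] by blast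
    have "\<forall>\<^sub>F n in sequentially. ys n \<in> ball z e"
      using tendstoD[OF ys e(1)] by (simp add: dist_commute)
    then obtain n0 where n0: "\<And>n. n \<ge> n0 \<Longrightarrow> ys n \<in> ball z e" unfolding eventually_sequentially by blast
    have "range (\<lambda>n. Ns (n + n0)) \<subseteq> {M. \<exists>z'\<in>ball z e. (F has_derivative (*v) M) (at z')}"
    proof (intro image_subsetI CollectI bexI)
      fix n show "(F has_derivative (*v) (Ns (n + n0))) (at (ys (n + n0)))" by (rule *(2))
      show "ys (n + n0) \<in> ball z e" by (rule n0) simp
    qed
    then have "bounded (range (\<lambda>n. Ns (n + n0)))" by (rule bounded_subset[OF e(2)])
    then obtain N s where s: "strict_mono s" "((\<lambda>n. Ns (n + n0)) \<circ> s) \<longlonglongrightarrow> N"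
      using bounded_imp_convergent_subsequence by blast
    have "(\<lambda>n. ys (s n + n0)) \<longlonglongrightarrow> z"
      using LIMSEQ_subseq_LIMSEQ[OF LIMSEQ_ignore_initial_segment[OF ys, of n0] s(1)] by (simp add: o_def)
    then have "N \<in> clarke_jac F z"
      unfolding clarke_jac_def using s(2) *(2)
      by (intro hull_inc CollectI exI[of _ "\<lambda>n. ys (s n + n0)"] exI[of _ "\<lambda>n. Ns (s n + n0)"]) (simp add: o_def)
    then have "a \<bullet> N > b" by (rule ab)
    moreover have "a \<bullet> N \<le> b"
    proof (rule tendsto_upperbound)
      show "((\<lambda>n. a \<bullet> Ns (s n + n0)) \<longlongrightarrow> a \<bullet> N) sequentially"
        using s(2) by (intro tendsto_intros) (simp add: o_def)
      show "\<forall>\<^sub>F n in sequentially. a \<bullet> Ns (s n + n0) \<le> b"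
        using *(3) by (intro always_eventually allI) (simp add: not_le less_imp_le)
    qed simp
    ultimately show False by simp
  qed
  then obtain e where e: "e > 0" "\<And>z' M'. z' \<in> ball z e \<Longrightarrow> (F has_derivative (*v) M') (at z') \<Longrightarrow> M' \<in> ?P"
    by blast
  have "\<forall>\<^sub>F n in sequentially. zs n \<in> ball z e"
    using tendstoD[OF zs e(1)] by (simp add: dist_commute)
  then have "\<forall>\<^sub>F n in sequentially. Ms n \<in> ?P"
  proof (rule eventually_mono)
    fix n assume "zs n \<in> ball z e"
    then obtain r where r: "r > 0" "ball (zs n) r \<subseteq> ball z e" using openE open_ball by blast
    have "clarke_jac F (zs n) \<subseteq> ?P"
      using e(2) r by (intro clarke_jac_subset[OF closed_halfspace_ge convex_halfspace_ge r(1)]) blast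
    then show "Ms n \<in> ?P" using Ms(1) by blast
  qed
  then have "M \<in> ?P" by (intro Lim_in_closed_set[OF closed_halfspace_ge _ _ Ms(2)]) auto
  then show False using ab(1) by simp
qed

lemma clarke_jac_convergent_subsequence:
  fixes F :: "real^'N \<Rightarrow> real^'m"
  assumes S: "open S" "z \<in> S" and F: "locally_lipschitz_on S F"
    and zs: "zs \<longlonglongrightarrow> z" and Ms: "\<And>n::nat. Ms n \<in> clarke_jac F (zs n)"
  obtains s M where "strict_mono s" "(Ms \<circ> s) \<longlonglongrightarrow> M" "M \<in> clarke_jac F z"
proof -
  obtain e where e: "e > 0" "bounded (\<Union>z'\<in>ball z e. clarke_jac F z')"
    using clarke_jac_bounded_near[OF S F] by blast
  have "\<forall>\<^sub>F n in sequentially. zs n \<in> ball z e"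
    using tendstoD[OF zs e(1)] by (simp add: dist_commute)
  then obtain n0 where n0: "\<And>n. n \<ge> n0 \<Longrightarrow> zs n \<in> ball z e" unfolding eventually_sequentially by blast
  have "range (\<lambda>n. Ms (n + n0)) \<subseteq> (\<Union>z'\<in>ball z e. clarke_jac F z')"
  proof clarify
    fix n show "Ms (n + n0) \<in> (\<Union>z'\<in>ball z e. clarke_jac F z')"
      by (rule UN_I[where a = "zs (n + n0)"]) (simp_all add: n0 Ms del: mem_ball)
  qed
  then have "bounded (range (\<lambda>n. Ms (n + n0)))" by (rule bounded_subset[OF e(2)])
  then obtain M s where s: "strict_mono s" "((\<lambda>n. Ms (n + n0)) \<circ> s) \<longlonglongrightarrow> M"
    using bounded_imp_convergent_subsequence by blast
  have s': "strict_mono (\<lambda>n. s n + n0)" using s(1) by (simp add: strict_mono_def)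
  moreover have lim: "(Ms \<circ> (\<lambda>n. s n + n0)) \<longlonglongrightarrow> M" using s(2) by (simp add: o_def)
  moreover have "M \<in> clarke_jac F z"
    by (rule clarke_jac_closed_graph[OF S F LIMSEQ_subseq_LIMSEQ[OF zs s'] _ lim]) (simp add: Ms)
  ultimately show thesis using that by blast
qed

text \<open>\<open>D\<close> is an arbitrary conservative Jacobian of \<open>F\<close>; it witnesses
  path differentiability, and the facts about the Clarke Jacobian are derived from it.\<close>

locale path_differentiable =
  fixes S :: "(real^'N) set" and F :: "real^'N \<Rightarrow> real^'m" and D :: "real^'N \<Rightarrow> (real^'N^'m) set"
  assumes open_S: "open S" and lip: "locally_lipschitz_on S F" and cons: "conservative_jac_on S F D"
begin

lemma D_nonempty: "z \<in> S \<Longrightarrow> D z \<noteq> {}"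
  using cons unfolding conservative_jac_on_def by blast

lemma D_curve:
  assumes "abs_cont_on 0 1 c" "c ` {0..1} \<subseteq> S"
  obtains N where "N \<in> null_sets lebesgue"
    "\<And>t. t \<in> {0..1} - N \<Longrightarrow> \<exists>v. (c has_vector_derivative v) (at t) \<and>
               (\<forall>M \<in> D (c t). ((F \<circ> c) has_vector_derivative (M *v v)) (at t))"
  using cons assms unfolding conservative_jac_on_def by metis

lemma D_convergent_subsequence:
  assumes z: "z \<in> S" and zs: "zs \<longlonglongrightarrow> z" "\<And>n::nat. zs n \<in> S" and Ms: "\<And>n. Ms n \<in> D (zs n)"
  obtains s M where "strict_mono s" "(Ms \<circ> s) \<longlonglongrightarrow> M" "M \<in> D z"
proof -
  obtain e where e: "e > 0" "bounded (\<Union> (D ` (ball z e \<inter> S)))"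
    using cons z unfolding conservative_jac_on_def by blast
  have "\<forall>\<^sub>F n in sequentially. zs n \<in> ball z e"
    using tendstoD[OF zs(1) e(1)] by (simp add: dist_commute)
  then obtain n0 where n0: "\<And>n. n \<ge> n0 \<Longrightarrow> zs n \<in> ball z e" unfolding eventually_sequentially by blast
  have "range (\<lambda>n. Ms (n + n0)) \<subseteq> \<Union> (D ` (ball z e \<inter> S))"
  proof clarify
    fix n
    have "zs (n + n0) \<in> ball z e \<inter> S" using n0 zs(2) by simp
    then show "Ms (n + n0) \<in> \<Union> (D ` (ball z e \<inter> S))" using Ms[of "n + n0"] by (rule UN_I)
  qed
  then have "bounded (range (\<lambda>n. Ms (n + n0)))" by (rule bounded_subset[OF e(2)])
  then obtain M s where s: "strict_mono s" "((\<lambda>n. Ms (n + n0)) \<circ> s) \<longlonglongrightarrow> M"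
    using bounded_imp_convergent_subsequence by blast
  have s': "strict_mono (\<lambda>n. s n + n0)" using s(1) by (simp add: strict_mono_def)
  moreover have lim: "(Ms \<circ> (\<lambda>n. s n + n0)) \<longlonglongrightarrow> M" using s(2) by (simp add: o_def)
  moreover have "M \<in> D z"
  proof -
    have "closedin (top_of_set (S \<times> UNIV)) (SIGMA z:S. D z)"
      using cons unfolding conservative_jac_on_def by blast
    from this[unfolded closed_graph_iff_sequential, rule_format,
        of "zs \<circ> (\<lambda>n. s n + n0)" z "Ms \<circ> (\<lambda>n. s n + n0)" M]
    show ?thesis using zs(2) z LIMSEQ_subseq_LIMSEQ[OF zs(1) s'] Ms lim by simp
  qed
  ultimately show thesis using that by blast
qed

text \<open>Elements outside \<open>U\<close> at points tending to \<open>z\<close> would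
  subconverge, by local boundedness, and the closed graph would put the limit into
  \<open>D z\<close>, while closedness of the complement keeps it outside \<open>U\<close>.\<close>

lemma D_upper_semicontinuous:
  assumes z: "z \<in> S" and U: "open U" "D z \<subseteq> U"
  obtains e where "e > 0" "ball z e \<subseteq> S" "\<And>z'. z' \<in> ball z e \<Longrightarrow> D z' \<subseteq> U"
proof -
  obtain e0 where e0: "e0 > 0" "ball z e0 \<subseteq> S" using z open_S openE by blast
  have "\<exists>e>0. \<forall>z'\<in>ball z e \<inter> S. D z' \<subseteq> U"
  proof (rule ccontr)
    assume *: "\<not> ?thesis"
    have "\<exists>z' M. z' \<in> ball z (1 / real (Suc n)) \<inter> S \<and> M \<in> D z' \<and> M \<notin> U" for n
    proof -
      have "\<not> (\<forall>z'\<in>ball z (1 / real (Suc n)) \<inter> S. D z' \<subseteq> U)"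
        using * by (metis of_nat_0_less_iff zero_less_Suc zero_less_divide_1_iff)
      then show ?thesis by blast
    qed
    then obtain zs Ms where zs: "\<And>n. zs n \<in> ball z (1 / real (Suc n)) \<inter> S" and Ms: "\<And>n. Ms n \<in> D (zs n)" "\<And>n. Ms n \<notin> U"
      by metis
    have "zs \<longlonglongrightarrow> z"
      by (rule metric_tendsto_imp_tendsto[OF LIMSEQ_inverse_real_of_nat])
        (use zs in \<open>auto simp: dist_commute inverse_eq_divide intro!: always_eventually less_imp_le\<close>)
    moreover have "zs n \<in> S" for n using zs by blast
    ultimately obtain s M where s: "strict_mono s" "(Ms \<circ> s) \<longlonglongrightarrow> M" "M \<in> D z"
      by (rule D_convergent_subsequence[OF z _ _ Ms(1)])
    have "M \<in> - U"
      by (rule closed_sequentially[of "- U" "Ms \<circ> s"]) (use U Ms s in auto)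
    then show False using U s by blast
  qed
  then obtain e where e: "e > 0" "\<And>z'. z' \<in> ball z e \<inter> S \<Longrightarrow> D z' \<subseteq> U" by blast
  show thesis
  proof (rule that)
    show "min e e0 > 0" using e e0 by simp
    show sub: "ball z (min e e0) \<subseteq> S" using e0 by auto
    show "D z' \<subseteq> U" if "z' \<in> ball z (min e e0)" for z'
      using that subsetD[OF sub that] by (intro e(2)) auto
  qed
qed

text \<open>A mean value inequality: along the segment, conservativity gives the derivative of w
  \<bullet> F at almost every time as w \<bullet> (M *v v) with \<open>M\<close> in
  \<open>D\<close>. The Lipschitz bound makes an almost everywhere derivative sufficient.\<close>

lemma segment_increment_le:
  assumes r: "ball z r \<subseteq> S" "L-lipschitz_on (ball z r) F" and v: "norm v < r"
    and le: "\<And>z' M. z' \<in> ball z r \<Longrightarrow> M \<in> D z' \<Longrightarrow> w \<bullet> (M *v v) \<le> C"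
  shows "w \<bullet> (F (z + v) - F z) \<le> C"
proof -
  define c where "c = (\<lambda>t. z + t *\<^sub>R v)"
  have c_ball: "c t \<in> ball z r" if "t \<in> {0..1}" for t
  proof -
    have "\<bar>t\<bar> * norm v \<le> 1 * norm v" using that by (intro mult_right_mono) auto
    then show ?thesis using v by (simp add: c_def dist_norm)
  qed
  obtain N where N: "N \<in> null_sets lebesgue" and
    cN: "\<And>t. t \<in> {0..1} - N \<Longrightarrow> \<exists>v. (c has_vector_derivative v) (at t) \<and>
               (\<forall>M \<in> D (c t). ((F \<circ> c) has_vector_derivative (M *v v)) (at t))"
    using D_curve[of c] abs_cont_on_line[of 0 1 z v] c_ball r(1) unfolding c_def[symmetric]
    by (metis image_subsetI subsetD)
  define \<phi> where "\<phi> = (\<lambda>t. w \<bullet> F (c t))"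
  have "\<phi> 1 - \<phi> 0 \<le> C * (1 - 0)"
  proof (rule lipschitz_ae_deriv_le_imp_increment_le[OF _ _ N])
    have "L \<ge> 0" using r(2) lipschitz_on_nonneg by blast
    show "(norm w * (L * norm v))-lipschitz_on {0..1} \<phi>"
    proof (rule lipschitz_onI)
      fix s t :: real assume st: "s \<in> {0..1}" "t \<in> {0..1}"
      have "dist (\<phi> s) (\<phi> t) = \<bar>w \<bullet> (F (c s) - F (c t))\<bar>"
        by (simp add: \<phi>_def dist_real_def inner_diff_right)
      also have "\<dots> \<le> norm w * norm (F (c s) - F (c t))" by (rule Cauchy_Schwarz_ineq2)
      also have "\<dots> \<le> norm w * (L * norm (c s - c t))"
        using lipschitz_onD[OF r(2) c_ball c_ball] st by (intro mult_left_mono) (auto simp: dist_norm)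
      also have "c s - c t = (s - t) *\<^sub>R v" by (simp add: c_def algebra_simps)
      finally show "dist (\<phi> s) (\<phi> t) \<le> norm w * (L * norm v) * dist s t"
        by (simp add: dist_real_def mult_ac)
    qed (use \<open>L \<ge> 0\<close> in simp)
  next
    fix t assume t: "t \<in> {0<..<1} - N"
    then obtain u where u: "(c has_vector_derivative u) (at t)"
      "\<And>M. M \<in> D (c t) \<Longrightarrow> ((F \<circ> c) has_vector_derivative (M *v u)) (at t)"
      using cN[of t] by auto
    have "(c has_vector_derivative v) (at t)"
      unfolding c_def by (auto intro!: derivative_eq_intros)
    then have uv: "u = v" using u(1) vector_derivative_unique_at by blast
    have "c t \<in> ball z r" using t by (intro c_ball) auto
    moreover from this obtain M where M: "M \<in> D (c t)" using D_nonempty r(1) by blast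
    ultimately have "w \<bullet> (M *v v) \<le> C" by (intro le)
    moreover have "(\<phi> has_real_derivative w \<bullet> (M *v v)) (at t)"
      using bounded_linear.has_vector_derivative[OF bounded_linear_inner_right u(2)[OF M], of w]
      by (simp add: uv \<phi>_def o_def has_real_derivative_iff_has_vector_derivative)
    ultimately show "\<exists>d\<le>C. (\<phi> has_real_derivative d) (at t)" by blast
  qed simp
  then show ?thesis by (simp add: \<phi>_def c_def inner_diff_right)
qed

lemma lipschitz_ball:
  assumes "z \<in> S"
  obtains r L where "r > 0" "ball z r \<subseteq> S" "L-lipschitz_on (ball z r) F"
proof -
  obtain e1 L where e1: "e1 > 0" "L-lipschitz_on (ball z e1 \<inter> S) F"
    using lip assms unfolding locally_lipschitz_on_def by blast
  obtain e2 where e2: "e2 > 0" "ball z e2 \<subseteq> S" using assms open_S openE by blast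
  have sub: "ball z (min e1 e2) \<subseteq> ball z e1 \<inter> S" using e2 by auto
  show thesis
    by (rule that[of "min e1 e2" L]) (use e1(1) e2(1) sub lipschitz_on_subset[OF e1(2) sub] in auto)
qed

text \<open>The bound is assumed on a whole ball because conservativity may fail to see the point
  \<open>z\<close> itself. Increments over segments that shrink to \<open>z\<close> are controlled
  by the values of \<open>D\<close> in the ball, and their limit is the derivative.\<close>

lemma derivative_inner_le:
  assumes z: "z \<in> S" and der: "(F has_derivative (\<lambda>h. M *v h)) (at z)" and e: "e > 0"
    and le: "\<And>z' M'. z' \<in> ball z e \<Longrightarrow> M' \<in> D z' \<Longrightarrow> w \<bullet> (M' *v v) \<le> C"
  shows "w \<bullet> (M *v v) \<le> C"
proof -
  obtain r0 L where r0: "r0 > 0" "ball z r0 \<subseteq> S" "L-lipschitz_on (ball z r0) F"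
    using lipschitz_ball[OF z] .
  define r where "r = min r0 e"
  have r: "r > 0" "ball z r \<subseteq> S" "L-lipschitz_on (ball z r) F"
    using r0 e by (auto simp: r_def intro: lipschitz_on_subset[OF r0(3)])
  show ?thesis
  proof (rule has_derivative_inner_le[OF der, of "r / (norm v + 1)"])
    show "0 < r / (norm v + 1)" using r by (simp add: add_nonneg_pos)
    fix t assume t: "0 < t" "t < r / (norm v + 1)"
    have "t * norm v \<le> t * (norm v + 1)" using t by (intro mult_left_mono) auto
    also have "\<dots> < r" using t by (simp add: pos_less_divide_eq add_nonneg_pos)
    finally have "norm (t *\<^sub>R v) < r" using t by simp
    then show "w \<bullet> (F (z + t *\<^sub>R v) - F z) \<le> t * C"
    proof (rule segment_increment_le[OF r(2,3)])
      fix z' M' assume "z' \<in> ball z r" "M' \<in> D z'"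
      then have "w \<bullet> (M' *v v) \<le> C" using le by (auto simp: r_def)
      then show "w \<bullet> (M' *v t *\<^sub>R v) \<le> t * C" using t by (simp add: matrix_vector_mult_scaleR)
    qed
  qed
qed

text \<open>Bounding functionals of rank one suffices, as only these enter the chain rule along curves, and it
  avoids the question whether the derivative lies in the convex hull of \<open>D z\<close>.\<close>
lemma clarke_jac_inner_le:
  assumes z: "z \<in> S" and M: "M \<in> clarke_jac F z"
    and le: "\<And>M'. M' \<in> D z \<Longrightarrow> w \<bullet> (M' *v v) \<le> C"
  shows "w \<bullet> (M *v v) \<le> C"
proof (rule field_le_epsilon)
  fix \<epsilon> :: real assume \<epsilon>: "\<epsilon> > 0"
  \<comment> \<open>The slack makes \<open>?U\<close> an open neighbourhood of \<open>D z\<close>,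
    so that upper semicontinuity spreads the bound to nearby points; \<open>?P\<close> is its closed
    convex counterpart.\<close>
  let ?U = "{M' :: real^'N^'m. w \<bullet> (M' *v v) < C + \<epsilon>}" and ?P = "{M' :: real^'N^'m. w \<bullet> (M' *v v) \<le> C + \<epsilon>}"
  have cont: "continuous_on UNIV (\<lambda>M' :: real^'N^'m. w \<bullet> (M' *v v))"
    by (intro continuous_intros continuous_on_matrix_vector_mult_left)
  have "open ?U" by (intro open_Collect_less cont continuous_on_const)
  moreover have "D z \<subseteq> ?U"
  proof
    fix M' assume "M' \<in> D z"
    then show "M' \<in> ?U" using le[of M'] \<epsilon> by simp
  qed
  ultimately obtain e where e: "e > 0" "ball z e \<subseteq> S" "\<And>z'. z' \<in> ball z e \<Longrightarrow> D z' \<subseteq> ?U"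
    using D_upper_semicontinuous[OF z] by metis
  have "clarke_jac F z \<subseteq> ?P"
  proof (rule clarke_jac_subset[OF _ _ e(1)])
    show "closed ?P" by (intro closed_Collect_le cont continuous_on_const)
    have "?P = (\<lambda>M'. w \<bullet> (M' *v v)) -` {..C + \<epsilon>}" by auto
    moreover have "linear (\<lambda>M' :: real^'N^'m. w \<bullet> (M' *v v))"
      by (intro linearI) (simp_all add: matrix_vector_mult_add_rdistrib scaleR_matrix_vector_assoc inner_add_right flip: inner_scaleR_right)
    ultimately show "convex ?P" by (simp only:) (intro convex_linear_vimage convex_real_interval)
    fix z' M' assume z': "z' \<in> ball z e" and der: "(F has_derivative (\<lambda>h. M' *v h)) (at z')"
    obtain r where r: "r > 0" "ball z' r \<subseteq> ball z e" using z' openE open_ball by blast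
    have "w \<bullet> (M' *v v) \<le> C + \<epsilon>"
    proof (rule derivative_inner_le[OF _ der r(1)])
      show "z' \<in> S" using z' e by blast
      fix z'' M'' assume "z'' \<in> ball z' r" "M'' \<in> D z''"
      then have "M'' \<in> ?U" using r e(3) by blast
      then show "w \<bullet> (M'' *v v) \<le> C + \<epsilon>" by simp
    qed
    then show "M' \<in> ?P" by simp
  qed
  then show "w \<bullet> (M *v v) \<le> C + \<epsilon>" using M by blast
qed

text \<open>At almost every time all elements of the conservative Jacobian agree on the velocity
  \<open>v\<close>, with common value \<open>M0 *v v\<close>. Testing the rank-one bound with the
  difference M v - M0 v shows that this difference has nonpositive square norm.\<close>

lemma clarke_jac_curve:
  assumes "abs_cont_on 0 1 c" "c ` {0..1} \<subseteq> S"
  obtains N where "N \<in> null_sets lebesgue"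
    "\<And>t. t \<in> {0..1} - N \<Longrightarrow> \<exists>v. (c has_vector_derivative v) (at t) \<and>
               (\<forall>M \<in> clarke_jac F (c t). ((F \<circ> c) has_vector_derivative (M *v v)) (at t))"
proof -
  obtain N where N: "N \<in> null_sets lebesgue"
    "\<And>t. t \<in> {0..1} - N \<Longrightarrow> \<exists>v. (c has_vector_derivative v) (at t) \<and>
               (\<forall>M \<in> D (c t). ((F \<circ> c) has_vector_derivative (M *v v)) (at t))"
    using D_curve[OF assms] by metis
  show thesis
  proof (rule that[OF N(1)])
    fix t assume t: "t \<in> {0..1} - N"
    then have ct: "c t \<in> S" using assms by auto
    obtain v where v: "(c has_vector_derivative v) (at t)"
      "\<And>M. M \<in> D (c t) \<Longrightarrow> ((F \<circ> c) has_vector_derivative (M *v v)) (at t)" using N(2)[OF t] by blast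
    obtain M0 where M0: "M0 \<in> D (c t)" using D_nonempty[OF ct] by blast
    have "M *v v = M0 *v v" if M: "M \<in> clarke_jac F (c t)" for M
    proof -
      let ?w = "M *v v - M0 *v v"
      have "?w \<bullet> (M *v v) \<le> ?w \<bullet> (M0 *v v)"
      proof (rule clarke_jac_inner_le[OF ct M])
        fix M' assume "M' \<in> D (c t)"
        then have "M' *v v = M0 *v v" using v(2) M0 vector_derivative_unique_at by blast
        then show "?w \<bullet> (M' *v v) \<le> ?w \<bullet> (M0 *v v)" by simp
      qed
      then have "?w \<bullet> ?w \<le> 0" by (simp add: inner_diff_right)
      then show ?thesis by (metis inner_ge_zero inner_eq_zero_iff order_antisym eq_iff_diff_eq_0)
    qed
    then show "\<exists>v. (c has_vector_derivative v) (at t) \<and>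
               (\<forall>M \<in> clarke_jac F (c t). ((F \<circ> c) has_vector_derivative (M *v v)) (at t))"
      using v M0 by metis
  qed
qed

text \<open>Near \<open>z\<close> the values of \<open>D\<close> are within \<epsilon> of
  \<open>M\<close> by upper semicontinuity. The mean value inequality, tested with the remainder
  itself as \<open>w\<close>, then bounds the remainder by \<epsilon> times the distance.\<close>

lemma has_derivative_if_D_singleton:
  assumes z: "z \<in> S" and M: "D z = {M}"
  shows "(F has_derivative (\<lambda>h. M *v h)) (at z)"
  unfolding has_derivative_at_alt
proof (intro conjI allI impI matrix_vector_mul_bounded_linear)
  fix \<epsilon> :: real assume \<epsilon>: "\<epsilon> > 0"
  obtain e where e: "e > 0" "ball z e \<subseteq> S" "\<And>z'. z' \<in> ball z e \<Longrightarrow> D z' \<subseteq> ball M \<epsilon>"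
    using D_upper_semicontinuous[OF z open_ball, of M \<epsilon>] M \<epsilon> by auto
  obtain r0 L where r0: "r0 > 0" "ball z r0 \<subseteq> S" "L-lipschitz_on (ball z r0) F"
    using lipschitz_ball[OF z] .
  define r where "r = min r0 e"
  have r: "r > 0" "ball z r \<subseteq> S" "L-lipschitz_on (ball z r) F"
    using r0 e by (auto simp: r_def intro: lipschitz_on_subset[OF r0(3)])
  have "norm (F y - F z - M *v (y - z)) \<le> \<epsilon> * norm (y - z)" if y: "norm (y - z) < r" for y
  proof -
    let ?v = "y - z" and ?w = "F y - F z - M *v (y - z)"
    have "?w \<bullet> (F (z + ?v) - F z) \<le> ?w \<bullet> (M *v ?v) + norm ?w * (\<epsilon> * norm ?v)"
    proof (rule segment_increment_le[OF r(2,3) y])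
      fix z' M' assume "z' \<in> ball z r" "M' \<in> D z'"
      then have "M' \<in> ball M \<epsilon>" using e(3)[of z'] by (auto simp: r_def)
      then have "norm (M' - M) \<le> \<epsilon>" by (simp add: dist_norm norm_minus_commute)
      have "?w \<bullet> (M' *v ?v) - ?w \<bullet> (M *v ?v) = ?w \<bullet> ((M' - M) *v ?v)"
        by (simp add: inner_diff_right matrix_vector_mult_diff_rdistrib)
      also have "\<dots> \<le> norm ?w * norm ((M' - M) *v ?v)" by (rule norm_cauchy_schwarz)
      also have "\<dots> \<le> norm ?w * (\<epsilon> * norm ?v)"
        by (intro mult_left_mono order_trans[OF norm_matrix_vector_mult_le] mult_right_mono
            \<open>norm (M' - M) \<le> \<epsilon>\<close>) auto
      finally show "?w \<bullet> (M' *v ?v) \<le> ?w \<bullet> (M *v ?v) + norm ?w * (\<epsilon> * norm ?v)" by simp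
    qed
    then have "?w \<bullet> ?w \<le> norm ?w * (\<epsilon> * norm ?v)" by (simp add: inner_diff_right)
    then have "norm ?w * norm ?w \<le> norm ?w * (\<epsilon> * norm ?v)"
      by (simp only: dot_square_norm power2_eq_square)
    then show ?thesis using \<epsilon> by (cases "norm ?w = 0") (simp, metis mult_le_cancel_left_pos norm_ge_zero order_le_less)
  qed
  then show "\<exists>d>0. \<forall>y. norm (y - z) < d \<longrightarrow> norm (F y - F z - M *v (y - z)) \<le> \<epsilon> * norm (y - z)"
    using r(1) by blast
qed

text \<open>The set where the \<open>j\<close>-th column of \<open>D\<close> oscillates by at least \<open>\<epsilon>\<close> is closed, and meets lines
  parallel to the \<open>j\<close>-th axis in null sets, so that it is nowhere dense. By Baire's theorem \<open>D\<close> is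
  single-valued on a dense set; this replaces Rademacher's theorem.\<close>
lemma D_singleton_dense:
  assumes z: "z \<in> S" and e: "e > 0"
  obtains y M where "y \<in> ball z e" "y \<in> S" "D y = {M}"
proof -
  obtain e1 where e1: "e1 > 0" "ball z e1 \<subseteq> S" using z open_S openE by blast
  define r where "r = min e e1 / 2"
  have r: "r > 0" using e e1 by (simp add: r_def)
  define K where "K = cball z r"
  have KS: "K \<subseteq> S" "K \<subseteq> ball z e" using e e1 by (auto simp: K_def r_def)
  define B where "B = (\<lambda>(j, k::nat). {y \<in> K. \<exists>M\<in>D y. \<exists>M'\<in>D y. norm (column j M - column j M') \<ge> 1 / real (Suc k)})"
  have column: "column j M = M *v axis j 1" for j and M :: "real^'N^'m"
    by (simp add: matrix_vector_mult_basis)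
  have clB: "closed (B p)" for p
    unfolding closed_sequential_limits
  proof (intro allI impI, elim conjE)
    fix ys y assume ys: "\<forall>n. ys n \<in> B p" "ys \<longlonglongrightarrow> y"
    obtain j k where p: "p = (j, k)" by (cases p)
    have "\<forall>n. \<exists>M M'. M \<in> D (ys n) \<and> M' \<in> D (ys n) \<and> norm (column j M - column j M') \<ge> 1 / real (Suc k)"
      using ys(1) unfolding B_def p by fastforce
    then obtain Ms Ms' where Ms: "\<And>n. Ms n \<in> D (ys n)" "\<And>n. Ms' n \<in> D (ys n)"
        "\<And>n. norm (column j (Ms n) - column j (Ms' n)) \<ge> 1 / real (Suc k)" by metis
    have ysK: "ys n \<in> K" for n using ys(1) unfolding B_def p by auto
    then have yK: "y \<in> K" using ys(2) unfolding K_def by (rule closed_sequentially[OF closed_cball])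
    obtain s M where s: "strict_mono s" "(Ms \<circ> s) \<longlonglongrightarrow> M" "M \<in> D y"
      using D_convergent_subsequence[OF _ ys(2) _ Ms(1)] yK ysK KS(1) by (metis subsetD)
    \<comment> \<open>The second extraction runs inside the first, so both matrix sequences converge
      along common indices.\<close>
    obtain s' M' where s': "strict_mono s'" "((Ms' \<circ> s) \<circ> s') \<longlonglongrightarrow> M'" "M' \<in> D y"
    proof (rule D_convergent_subsequence[of y "ys \<circ> s" "Ms' \<circ> s"])
      show "y \<in> S" "(ys \<circ> s) n \<in> S" for n using yK ysK KS(1) by auto
      show "(ys \<circ> s) \<longlonglongrightarrow> y" by (rule LIMSEQ_subseq_LIMSEQ[OF ys(2) s(1)])
      show "(Ms' \<circ> s) n \<in> D ((ys \<circ> s) n)" for n using Ms(2) by simp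
    qed
    have M1: "((Ms \<circ> s) \<circ> s') \<longlonglongrightarrow> M" by (rule LIMSEQ_subseq_LIMSEQ[OF s(2) s'(1)])
    have "(\<lambda>n. norm (column j (Ms (s (s' n))) - column j (Ms' (s (s' n))))) \<longlonglongrightarrow> norm (column j M - column j M')"
      unfolding column using M1 s'(2)
      by (intro tendsto_norm tendsto_diff tendsto_matrix_vector_mult tendsto_const) (simp_all add: o_def)
    then have "1 / real (Suc k) \<le> norm (column j M - column j M')"
      by (rule tendsto_lowerbound) (use Ms(3) in \<open>auto intro: always_eventually\<close>)
    then show "y \<in> B p" using s(3) s'(3) yK unfolding B_def p by auto
  qed
  have dense: "K \<subseteq> closure (K - B p)" for p
  proof
    fix y assume y: "y \<in> K"
    obtain j k where p: "p = (j, k)" by (cases p)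
    show "y \<in> closure (K - B p)"
      unfolding closure_approachable
    proof (intro allI impI)
      fix d :: real assume d: "d > 0"
      \<comment> \<open>A point \<open>y\<close> on the boundary of \<open>K\<close> may leave no
        room for a segment in direction \<open>j\<close>, so an interior point \<open>x\<close>
        close to it is used instead.\<close>
      have "y \<in> closure (ball z r)" using y r by (simp add: K_def)
      then obtain x where x: "x \<in> ball z r" "dist x y < d / 2"
        using d unfolding closure_approachable by (meson half_gt_zero)
      obtain q where q: "q > 0" "ball x q \<subseteq> ball z r" using x(1) openE open_ball by blast
      define \<eta> where "\<eta> = min q d / 2"
      have \<eta>: "\<eta> > 0" "\<eta> < q" "\<eta> \<le> d / 2" using q d by (auto simp: \<eta>_def)
      define c where "c = (\<lambda>t. x + t *\<^sub>R (\<eta> *\<^sub>R (axis j 1 :: real^'N)))"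
      have c_dist: "dist (c t) x \<le> \<eta>" if "t \<in> {0..1}" for t
        using that \<eta> by (simp add: c_def dist_norm abs_mult mult_left_le_one_le)
      have c_ball: "c t \<in> ball z r" if "t \<in> {0..1}" for t
      proof -
        have "c t \<in> ball x q" using c_dist[OF that] \<eta>(2) by (simp add: dist_commute)
        then show ?thesis using q(2) by blast
      qed
      have "c ` {0..1} \<subseteq> S" using c_ball KS(1) unfolding K_def by force
      then obtain N where N: "N \<in> null_sets lebesgue" and
        cN: "\<And>t. t \<in> {0..1} - N \<Longrightarrow> \<exists>v. (c has_vector_derivative v) (at t) \<and>
               (\<forall>M \<in> D (c t). ((F \<circ> c) has_vector_derivative (M *v v)) (at t))"
        using D_curve[of c] abs_cont_on_line[of 0 1 x "\<eta> *\<^sub>R (axis j 1 :: real^'N)"]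
        unfolding c_def[symmetric] by metis
      have "\<not> {0<..<1::real} \<subseteq> N"
        using N open_not_negligible[of "{0<..<1::real}"] negligible_subset[of N "{0<..<1}"]
        by (auto simp: negligible_iff_null_sets)
      then obtain t where t: "t \<in> {0<..<1}" "t \<notin> N" by blast
      then have t01: "t \<in> {0..1}" by auto
      obtain v where v: "(c has_vector_derivative v) (at t)"
        "\<And>M. M \<in> D (c t) \<Longrightarrow> ((F \<circ> c) has_vector_derivative (M *v v)) (at t)"
        using cN[of t] t t01 by auto
      have "(c has_vector_derivative \<eta> *\<^sub>R axis j 1) (at t)"
        unfolding c_def by (auto intro!: derivative_eq_intros)
      then have vj: "v = \<eta> *\<^sub>R axis j 1" using v(1) vector_derivative_unique_at by blast
      \<comment> \<open>The velocity is a nonzero multiple of the \<open>j\<close>-th axis vector,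
        so agreement of the matrices on it is agreement of their \<open>j\<close>-th
        columns.\<close>
      have col: "column j M = column j M'" if "M \<in> D (c t)" "M' \<in> D (c t)" for M M'
      proof -
        have "M *v v = M' *v v"
          by (rule vector_derivative_unique_at[OF v(2)[OF that(1)] v(2)[OF that(2)]])
        then show ?thesis using \<eta>(1) unfolding column vj by (simp add: matrix_vector_mult_scaleR)
      qed
      have "c t \<notin> B p"
      proof
        assume "c t \<in> B p"
        then obtain M M' where M: "M \<in> D (c t)" "M' \<in> D (c t)" "1 / real (Suc k) \<le> norm (column j M - column j M')"
          unfolding B_def p by auto
        show False using M(3) unfolding col[OF M(1,2)] by simp
      qed
      moreover have "c t \<in> K" using c_ball[OF t01] by (auto simp: K_def)
      moreover have "dist (c t) y < d"
        using dist_triangle[of "c t" y x] c_dist[OF t01] x(2) \<eta>(3) by simp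
      ultimately show "\<exists>y'\<in>K - B p. dist y' y < d" by blast
    qed
  qed
  let ?G = "range (\<lambda>p. K - B p)"
  have Ksub: "K \<subseteq> closure (\<Inter>?G)"
  proof (rule Baire)
    show "closed K" by (simp add: K_def)
    show "countable ?G" by simp
    fix T assume "T \<in> ?G"
    then obtain p where T: "T = K - B p" by blast
    have "openin (top_of_set K) (K - B p)"
      using clB[of p] openin_open_Int[of "- B p" K] by (simp add: Diff_eq open_Compl)
    then show "openin (top_of_set K) T \<and> K \<subseteq> closure T" using dense T by blast
  qed
  have "z \<in> K" using r by (simp add: K_def)
  from subsetD[OF Ksub this] have "closure (\<Inter>?G) \<noteq> {}" by (metis empty_iff)
  then have "\<Inter>?G \<noteq> {}" by (metis closure_empty)
  then obtain y where y: "\<And>p. y \<in> K - B p" by blast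
  then have yS: "y \<in> S" "y \<in> ball z e" and yK: "y \<in> K" using KS by blast+
  obtain M where M: "M \<in> D y" using D_nonempty[OF yS(1)] by blast
  have "M' = M" if M': "M' \<in> D y" for M'
  proof -
    have "column j M' = column j M" for j
    proof (rule ccontr)
      assume "column j M' \<noteq> column j M"
      then have "norm (column j M' - column j M) > 0" by simp
      then obtain k where "inverse (real (Suc k)) < norm (column j M' - column j M)"
        using reals_Archimedean by blast
      then have "y \<in> B (j, k)" unfolding B_def using M M' yK
        by (auto simp: inverse_eq_divide intro: less_imp_le)
      then show False using y by blast
    qed
    then show ?thesis by (simp add: vec_eq_iff column_def)
  qed
  with M have "D y = {M}" by blast
  with yS show thesis using that by blast
qed

text \<open>The derivatives at points of single-valuedness lie in \<open>D\<close>. Local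
  boundedness of \<open>D\<close> therefore lets them subconverge as the points tend to
  \<open>z\<close>, and the limit is a limiting Jacobian.\<close>

lemma clarke_jac_nonempty:
  assumes z: "z \<in> S"
  shows "clarke_jac F z \<noteq> {}"
proof -
  have "\<exists>y M. y \<in> ball z (1 / real (Suc n)) \<and> y \<in> S \<and> D y = {M}" for n
    using D_singleton_dense[OF z, of "1 / real (Suc n)"] by (metis of_nat_0_less_iff zero_less_Suc zero_less_divide_1_iff)
  then obtain ys Ms where ys: "\<And>n. ys n \<in> ball z (1 / real (Suc n))" "\<And>n. ys n \<in> S" and Ms: "\<And>n. D (ys n) = {Ms n}"
    by metis
  have lim: "ys \<longlonglongrightarrow> z"
    by (rule metric_tendsto_imp_tendsto[OF LIMSEQ_inverse_real_of_nat])
      (use ys in \<open>auto simp: dist_commute inverse_eq_divide intro!: always_eventually less_imp_le\<close>)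
  have "Ms n \<in> D (ys n)" for n using Ms by simp
  then obtain s M where s: "strict_mono s" "(Ms \<circ> s) \<longlonglongrightarrow> M"
    using D_convergent_subsequence[OF z lim ys(2)] by metis
  have "M \<in> clarke_jac F z"
    unfolding clarke_jac_def
  proof (intro hull_inc CollectI exI conjI allI)
    show "(ys \<circ> s) \<longlonglongrightarrow> z" by (rule LIMSEQ_subseq_LIMSEQ[OF lim s(1)])
    show "(Ms \<circ> s) \<longlonglongrightarrow> M" by (rule s)
    show "(F has_derivative (\<lambda>h. (Ms \<circ> s) k *v h)) (at ((ys \<circ> s) k))" for k
      using has_derivative_if_D_singleton[OF ys(2) Ms] by simp
  qed
  then show ?thesis by blast
qed

end

section \<open>Fixed points of parametric contractions\<close>

lemma part1_join [simp]: "part1 (join a b) = a" and part2_join [simp]: "part2 (join a b) = b"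
  and join_parts [simp]: "join (part1 z) (part2 z) = z"
  by (simp_all add: part1_def part2_def join_def vec_eq_iff split: sum.splits)

lemma linear_join: "linear (\<lambda>p. join (fst p) (snd p))"
  by (rule linearI) (auto simp: join_def vec_eq_iff split: sum.splits)

lemma bounded_linear_part1: "bounded_linear part1" and bounded_linear_part2: "bounded_linear part2"
  by (auto intro!: linearI simp: linear_conv_bounded_linear[symmetric] part1_def part2_def vec_eq_iff)

lemma bounded_linear_join: "bounded_linear (\<lambda>p. join (fst p) (snd p))"
  using linear_join linear_conv_bounded_linear by blast

lemma matrix_vector_mult_join: "M *v join u v = blockU M *v u + blockV M *v v"
  by (simp add: matrix_vector_mult_def join_def blockU_def blockV_def vec_eq_iff
      UNIV_Plus_UNIV[symmetric] sum.Plus del: UNIV_Plus_UNIV)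

lemma norm_join_le: "norm (join a b) \<le> norm a + norm b"
proof -
  have "norm (join a b) \<le> sqrt ((norm a)\<^sup>2 + (norm b)\<^sup>2)"
    unfolding norm_vec_def L2_set_def
    by (simp add: join_def UNIV_Plus_UNIV[symmetric] sum.Plus sum_nonneg del: UNIV_Plus_UNIV)
  also have "\<dots> \<le> norm a + norm b" by (rule sqrt_sum_squares_le_sum) auto
  finally show ?thesis .
qed

lemma join_diff: "join a b - join a' b' = join (a - a') (b - b')"
  by (simp add: join_def vec_eq_iff split: sum.splits)

lemma join_add: "join a b + join a' b' = join (a + a') (b + b')"
  by (simp add: join_def vec_eq_iff split: sum.splits)

lemma dist_join_le: "dist (join a b) (join a' b') \<le> dist a a' + dist b b'"
  using norm_join_le[of "a - a'" "b - b'"] by (simp add: dist_norm join_diff)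

lemma open_part1_vimage: "open \<Theta> \<Longrightarrow> open {z. part1 z \<in> \<Theta>}"
  using continuous_open_vimage[of \<Theta> part1] linear_continuous_at[OF bounded_linear_part1]
  by (auto simp: vimage_def)

lemma tendsto_matrix_matrix_mult:
  fixes A :: "'b \<Rightarrow> real^'n^'m" and B :: "'b \<Rightarrow> real^'k^'n"
  assumes "(A \<longlongrightarrow> A0) F" "(B \<longlongrightarrow> B0) F"
  shows "((\<lambda>x. A x ** B x) \<longlongrightarrow> A0 ** B0) F"
  unfolding matrix_matrix_mult_def by (intro vec_tendstoI) (auto intro!: tendsto_intros assms)

lemma tendsto_blockU: "(M \<longlongrightarrow> M0) F \<Longrightarrow> ((\<lambda>x. blockU (M x)) \<longlongrightarrow> blockU M0) F"
  and tendsto_blockV: "(M \<longlongrightarrow> M0) F \<Longrightarrow> ((\<lambda>x. blockV (M x)) \<longlongrightarrow> blockV M0) F"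
  unfolding blockU_def blockV_def by (intro vec_tendstoI; auto intro!: tendsto_intros)+

lemma matrix_inv_inverse:
  fixes A :: "real^'n^'n"
  assumes "invertible A"
  shows "A ** matrix_inv A = mat 1" "matrix_inv A ** A = mat 1"
proof -
  have "A ** matrix_inv A = mat 1 \<and> matrix_inv A ** A = mat 1"
    unfolding matrix_inv_def by (rule someI_ex) (use assms in \<open>simp add: invertible_def\<close>)
  then show "A ** matrix_inv A = mat 1" "matrix_inv A ** A = mat 1" by auto
qed

lemma locally_lipschitz_on_compose:
  assumes F: "locally_lipschitz_on S F" and sub: "F ` S \<subseteq> S'" and H: "locally_lipschitz_on S' H"
  shows "locally_lipschitz_on S (\<lambda>z. H (F z))"
  unfolding locally_lipschitz_on_def
proof
  fix z assume z: "z \<in> S"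
  obtain e L where e: "e > 0" "L-lipschitz_on (ball z e \<inter> S) F"
    using F z unfolding locally_lipschitz_on_def by blast
  have "F z \<in> S'" using z sub by blast
  then obtain e' L' where e': "e' > 0" "L'-lipschitz_on (ball (F z) e' \<inter> S') H"
    using H unfolding locally_lipschitz_on_def by blast
  have L: "L \<ge> 0" using e(2) lipschitz_on_nonneg by blast
  \<comment> \<open>The second term makes \<open>F\<close> map the ball into the one around
    \<open>F z\<close> on which \<open>H\<close> is Lipschitz; L + 1 covers the case L = 0.\<close>
  define d where "d = min e (e' / (L + 1))"
  have d: "d > 0" using e e' L by (simp add: d_def)
  have "F ` (ball z d \<inter> S) \<subseteq> ball (F z) e' \<inter> S'"
  proof (intro image_subsetI IntI)
    fix y assume y: "y \<in> ball z d \<inter> S"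
    then have "dist (F z) (F y) \<le> L * dist z y"
      using e z by (intro lipschitz_onD[OF e(2)]) (auto simp: d_def)
    also have "\<dots> \<le> (L + 1) * dist z y" by (intro mult_right_mono) auto
    also have "\<dots> < (L + 1) * d" using y L by (intro mult_strict_left_mono) auto
    also have "\<dots> \<le> (L + 1) * (e' / (L + 1))" using L by (intro mult_left_mono) (auto simp: d_def)
    finally show "F y \<in> ball (F z) e'" using L by simp
    show "F y \<in> S'" using y sub by blast
  qed
  then have "L'-lipschitz_on (F ` (ball z d \<inter> S)) H" by (rule lipschitz_on_subset[OF e'(2)])
  moreover have "L-lipschitz_on (ball z d \<inter> S) F" by (rule lipschitz_on_subset[OF e(2)]) (auto simp: d_def)
  ultimately have "(L' * L)-lipschitz_on (ball z d \<inter> S) (\<lambda>z. H (F z))" by (rule lipschitz_on_compose2[rotated])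
  then show "\<exists>e>0. \<exists>L. L-lipschitz_on (ball z e \<inter> S) (\<lambda>z. H (F z))" using d by blast
qed

lemma locally_lipschitz_on_tendsto:
  assumes F: "locally_lipschitz_on S F" and z: "z \<in> S" and zs: "zs \<longlonglongrightarrow> z" "\<And>n::nat. zs n \<in> S"
  shows "(\<lambda>n. F (zs n)) \<longlonglongrightarrow> F z"
proof -
  obtain e L where e: "e > 0" "L-lipschitz_on (ball z e \<inter> S) F"
    using F z unfolding locally_lipschitz_on_def by blast
  have "\<forall>\<^sub>F n in sequentially. zs n \<in> ball z e \<inter> S"
    using tendstoD[OF zs(1) e(1)] zs(2) by (auto simp: dist_commute elim: eventually_mono)
  then show ?thesis
    using z e(1) by (intro continuous_on_tendsto_compose[OF lipschitz_on_continuous_on[OF e(2)] zs(1)]) auto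
qed

lemma locally_lipschitz_on_bounded_linear:
  assumes "bounded_linear H"
  shows "locally_lipschitz_on S H"
  unfolding locally_lipschitz_on_def
proof
  fix z
  obtain L where "L-lipschitz_on (ball z 1 \<inter> S) H" using bounded_linear.lipschitz_boundE[OF assms] by blast
  then show "\<exists>e>0. \<exists>L. L-lipschitz_on (ball z e \<inter> S) H" by (intro exI[of _ 1]) auto
qed

lemma locally_lipschitz_on_Pair:
  assumes F: "locally_lipschitz_on S F" and H: "locally_lipschitz_on S H"
  shows "locally_lipschitz_on S (\<lambda>z. (F z, H z))"
  unfolding locally_lipschitz_on_def
proof
  fix z assume z: "z \<in> S"
  obtain e L where e: "e > 0" "L-lipschitz_on (ball z e \<inter> S) F"
    using F z unfolding locally_lipschitz_on_def by blast
  obtain e' L' where e': "e' > 0" "L'-lipschitz_on (ball z e' \<inter> S) H"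
    using H z unfolding locally_lipschitz_on_def by blast
  let ?X = "ball z (min e e') \<inter> S"
  have "L-lipschitz_on ?X F" "L'-lipschitz_on ?X H"
    by (rule lipschitz_on_subset[OF e(2)] lipschitz_on_subset[OF e'(2)], auto)+
  then have "(sqrt (L\<^sup>2 + L'\<^sup>2))-lipschitz_on ?X (\<lambda>z. (F z, H z))" by (rule lipschitz_on_Pair)
  then show "\<exists>e>0. \<exists>L. L-lipschitz_on (ball z e \<inter> S) (\<lambda>z. (F z, H z))"
    using e(1) e'(1) by (intro exI[of _ "min e e'"]) auto
qed

lemma locally_lipschitz_on_join:
  assumes "locally_lipschitz_on S F" "locally_lipschitz_on S H"
  shows "locally_lipschitz_on S (\<lambda>z. join (F z) (H z))"
  using locally_lipschitz_on_compose[OF locally_lipschitz_on_Pair[OF assms] subset_UNIV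
      locally_lipschitz_on_bounded_linear[OF bounded_linear_join]] by simp

lemma locally_lipschitz_on_diff_scaleR:
  fixes F H :: "'a::metric_space \<Rightarrow> 'b::real_normed_vector"
  assumes "locally_lipschitz_on S F" "locally_lipschitz_on S H"
  shows "locally_lipschitz_on S (\<lambda>z. F z - c *\<^sub>R H z)"
proof -
  have "bounded_linear (\<lambda>p :: 'b \<times> 'b. fst p - c *\<^sub>R snd p)"
    by (intro bounded_linear_sub bounded_linear_fst bounded_linear_compose[OF bounded_linear_scaleR_right bounded_linear_snd])
  from locally_lipschitz_on_compose[OF locally_lipschitz_on_Pair[OF assms] subset_UNIV
      locally_lipschitz_on_bounded_linear[OF this]]
  show ?thesis by simp
qed

lemma has_derivative_join_second: "((\<lambda>x. join \<theta> x) has_derivative (\<lambda>h. join 0 h)) (at x)"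
proof -
  have "linear (\<lambda>h. join 0 h)"
    by (rule linearI) (auto simp: join_def vec_eq_iff split: sum.splits)
  then have "((\<lambda>x. join \<theta> 0 + join 0 x) has_derivative (\<lambda>h. 0 + join 0 h)) (at x)"
    by (intro has_derivative_add has_derivative_const linear_imp_has_derivative)
  then show ?thesis by (simp add: join_add)
qed

text \<open>Taking \<open>s = 0\<close>, \<open>c = 1\<close> gives the proximal estimate, and
  \<open>s = 1\<close>, c = -\<gamma> that of the gradient step. A joint derivative restricts to the
  derivative in \<open>x\<close> through the vector join 0 h. The estimate has to hold for all
  \<theta> since differentiability points near \<open>z\<close> have other parameters.\<close>

lemma clarke_jac_blockV_norm_le:
  fixes F :: "real^('p::finite + 'n::finite) \<Rightarrow> real^'n"
  assumes \<Theta>: "open \<Theta>" "part1 z \<in> \<Theta>"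
    and lip: "\<And>\<theta> x y. \<theta> \<in> \<Theta> \<Longrightarrow>
      norm (s *\<^sub>R (x - y) + c *\<^sub>R (F (join \<theta> x) - F (join \<theta> y))) \<le> \<kappa> * norm (x - y)"
    and M: "M \<in> clarke_jac F z"
  shows "norm (s *\<^sub>R h + c *\<^sub>R (blockV M *v h)) \<le> \<kappa> * norm h"
proof -
  let ?P = "{M :: real^('p + 'n)^'n. norm (s *\<^sub>R h + c *\<^sub>R (M *v join 0 h)) \<le> \<kappa> * norm h}"
  obtain e where e: "e > 0" "ball z e \<subseteq> {z. part1 z \<in> \<Theta>}"
    using openE[OF open_part1_vimage[OF \<Theta>(1)]] \<Theta>(2) by blast
  have "clarke_jac F z \<subseteq> ?P"
  proof (rule clarke_jac_subset[OF _ _ e(1)])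
    show "closed ?P"
      by (intro closed_Collect_le continuous_intros continuous_on_matrix_vector_mult_left)
    have "?P = (\<lambda>M. c *\<^sub>R (M *v join 0 h)) -` cball (- (s *\<^sub>R h)) (\<kappa> * norm h)"
      by (auto simp: dist_norm norm_minus_commute) (metis add.commute diff_minus_eq_add norm_minus_commute)+
    moreover have "linear (\<lambda>M :: real^('p + 'n)^'n. c *\<^sub>R (M *v join 0 h))"
      by (intro linearI)
        (simp_all add: matrix_vector_mult_add_rdistrib scaleR_matrix_vector_assoc[symmetric] scaleR_add_right)
    ultimately show "convex ?P" by (simp only:) (intro convex_linear_vimage convex_cball)
    fix z' M' assume z': "z' \<in> ball z e" and d: "(F has_derivative (\<lambda>h. M' *v h)) (at z')"
    define \<theta> x where "\<theta> = part1 z'" and "x = part2 z'"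
    have \<theta>: "\<theta> \<in> \<Theta>" using z' e(2) by (auto simp: \<theta>_def)
    have "(F has_derivative (\<lambda>h. M' *v h)) (at (join \<theta> x))" using d by (simp add: \<theta>_def x_def)
    from has_derivative_compose[OF has_derivative_join_second this]
    have d': "((\<lambda>x. s *\<^sub>R x + c *\<^sub>R F (join \<theta> x)) has_derivative (\<lambda>h. s *\<^sub>R h + c *\<^sub>R (M' *v join 0 h))) (at x)"
      by (auto intro!: derivative_eq_intros)
    have "norm (s *\<^sub>R h + c *\<^sub>R (M' *v join 0 h)) \<le> \<kappa> * norm h"
    proof (rule has_derivative_norm_le_lipschitz[OF d' zero_less_one])
      fix t :: real
      show "norm (s *\<^sub>R (x + t *\<^sub>R h) + c *\<^sub>R F (join \<theta> (x + t *\<^sub>R h)) - (s *\<^sub>R x + c *\<^sub>R F (join \<theta> x))) \<le> \<kappa> * norm (t *\<^sub>R h)"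
        using lip[OF \<theta>, of "x + t *\<^sub>R h" x] by (simp add: algebra_simps)
    qed
    then show "M' \<in> ?P" by simp
  qed
  then have "norm (s *\<^sub>R h + c *\<^sub>R (M *v join 0 h)) \<le> \<kappa> * norm h" using M by blast
  then show ?thesis by (simp add: matrix_vector_mult_join)
qed

text \<open>The forward-backward map, reduced to the Lipschitz factors \<open>\<kappa>\<close> of
  the backward and \<open>q\<close> of the forward step. Only their product is required to be below
  1, since \<open>q\<close> exceeds 1 when the strong convexity is that of the nonsmooth
  term.\<close>

locale parametric_fixed_point =
  fixes \<Theta> :: "(real^'p) set" and T G :: "real^('p + 'n) \<Rightarrow> real^'n" and xs :: "real^'p \<Rightarrow> real^'n"
    and \<gamma> \<kappa> q :: real
  assumes open_\<Theta>: "open \<Theta>"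
    and T_pd: "path_diff_on {z. part1 z \<in> \<Theta>} T" and G_pd: "path_diff_on {z. part1 z \<in> \<Theta>} G"
    and \<kappa>: "0 \<le> \<kappa>" and contr: "\<kappa> * q < 1"
    and T_lip: "\<And>\<theta> x y. \<theta> \<in> \<Theta> \<Longrightarrow> norm (T (join \<theta> x) - T (join \<theta> y)) \<le> \<kappa> * norm (x - y)"
    and G_step: "\<And>\<theta> x y. \<theta> \<in> \<Theta> \<Longrightarrow>
      norm ((x - \<gamma> *\<^sub>R G (join \<theta> x)) - (y - \<gamma> *\<^sub>R G (join \<theta> y))) \<le> q * norm (x - y)"
    and fixed: "\<And>\<theta>. \<theta> \<in> \<Theta> \<Longrightarrow> T (join \<theta> (xs \<theta> - \<gamma> *\<^sub>R G (join \<theta> (xs \<theta>)))) = xs \<theta>"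
begin

definition base_G :: "real^'p \<Rightarrow> real^('p + 'n)" where "base_G \<theta> = join \<theta> (xs \<theta>)"

definition base_T :: "real^'p \<Rightarrow> real^('p + 'n)" where "base_T \<theta> = join \<theta> (xs \<theta> - \<gamma> *\<^sub>R G (join \<theta> (xs \<theta>)))"

text \<open>Formal differentiation of x = T (\<theta>, x - \<gamma> G (\<theta>, x)), with the terms
  in dx collected on one side, reads lhs dx = rhs d\<theta>.\<close>

definition lhs :: "real^('p + 'n)^'n \<Rightarrow> real^('p + 'n)^'n \<Rightarrow> real^'n^'n" where
  "lhs UV WZ = mat 1 - blockV UV ** (mat 1 - \<gamma> *\<^sub>R blockV WZ)"

definition rhs :: "real^('p + 'n)^'n \<Rightarrow> real^('p + 'n)^'n \<Rightarrow> real^'p^'n" where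
  "rhs UV WZ = blockU UV - \<gamma> *\<^sub>R (blockV UV ** blockU WZ)"

definition J :: "real^'p \<Rightarrow> (real^'p^'n) set" where
  "J \<theta> = {matrix_inv (lhs UV WZ) ** rhs UV WZ | UV WZ.
      UV \<in> clarke_jac T (base_T \<theta>) \<and> WZ \<in> clarke_jac G (base_G \<theta>)}"

abbreviation S :: "(real^('p + 'n)) set" where "S \<equiv> {z. part1 z \<in> \<Theta>}"

lemma open_S: "open S"
  by (rule open_part1_vimage[OF open_\<Theta>])

lemma T_ll: "locally_lipschitz_on S T" and G_ll: "locally_lipschitz_on S G"
  using T_pd G_pd unfolding path_diff_on_def by blast+

lemma base_in_S: "\<theta> \<in> \<Theta> \<Longrightarrow> base_T \<theta> \<in> S" "\<theta> \<in> \<Theta> \<Longrightarrow> base_G \<theta> \<in> S"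
  by (simp_all add: base_T_def base_G_def)

text \<open>V has norm at most \<kappa> and Id - \<gamma> Z at most q, so the reverse triangle
  inequality applies. The constant does not depend on the chosen Jacobians, which gives local
  boundedness of \<open>J\<close> besides invertibility.\<close>

lemma lhs_norm_ge:
  assumes UV: "UV \<in> clarke_jac T (base_T \<theta>)" and WZ: "WZ \<in> clarke_jac G (base_G \<theta>)" and \<theta>: "\<theta> \<in> \<Theta>"
  shows "(1 - \<kappa> * q) * norm h \<le> norm (lhs UV WZ *v h)"
proof -
  have "norm (0 *\<^sub>R k + 1 *\<^sub>R (blockV UV *v k)) \<le> \<kappa> * norm k" for k
    by (rule clarke_jac_blockV_norm_le[OF open_\<Theta> _ _ UV]) (use \<theta> T_lip in \<open>simp_all add: base_T_def\<close>)
  then have V: "norm (blockV UV *v k) \<le> \<kappa> * norm k" for k by simp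
  have Z: "norm (1 *\<^sub>R h + (- \<gamma>) *\<^sub>R (blockV WZ *v h)) \<le> q * norm h"
  proof (rule clarke_jac_blockV_norm_le[OF open_\<Theta> _ _ WZ])
    fix \<theta> x y assume "\<theta> \<in> \<Theta>"
    from G_step[OF this, of x y]
    show "norm (1 *\<^sub>R (x - y) + (- \<gamma>) *\<^sub>R (G (join \<theta> x) - G (join \<theta> y))) \<le> q * norm (x - y)"
      by (simp add: algebra_simps)
  qed (use \<theta> in \<open>simp add: base_G_def\<close>)
  have eq: "lhs UV WZ *v h = h - blockV UV *v (h - \<gamma> *\<^sub>R (blockV WZ *v h))"
    by (simp add: lhs_def matrix_vector_mult_diff_rdistrib matrix_vector_mul_assoc[symmetric]
        scaleR_matrix_vector_assoc)
  have "norm (blockV UV *v (h - \<gamma> *\<^sub>R (blockV WZ *v h))) \<le> \<kappa> * (q * norm h)"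
    using V[of "h - \<gamma> *\<^sub>R (blockV WZ *v h)"] mult_left_mono[OF Z \<kappa>] by simp
  then have "norm h - \<kappa> * (q * norm h) \<le> norm (lhs UV WZ *v h)"
    unfolding eq using norm_triangle_ineq2[of h "blockV UV *v (h - \<gamma> *\<^sub>R (blockV WZ *v h))"] by linarith
  then show ?thesis by (simp add: algebra_simps)
qed

lemma lhs_invertible:
  assumes "UV \<in> clarke_jac T (base_T \<theta>)" "WZ \<in> clarke_jac G (base_G \<theta>)" "\<theta> \<in> \<Theta>"
  shows "invertible (lhs UV WZ)"
  unfolding invertible_left_inverse matrix_left_invertible_injective
proof (rule injI)
  fix x y assume "lhs UV WZ *v x = lhs UV WZ *v y"
  then have "(1 - \<kappa> * q) * norm (x - y) \<le> 0"
    using lhs_norm_ge[OF assms, of "x - y"] by (simp add: matrix_vector_mult_diff_distrib)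
  then show "x = y" using contr by (simp add: mult_le_0_iff)
qed

text \<open>Membership is rewritten as a linear equation, so limits can be taken without continuity
  of matrix inversion.\<close>

lemma J_iff:
  assumes "\<theta> \<in> \<Theta>"
  shows "N \<in> J \<theta> \<longleftrightarrow> (\<exists>UV WZ. UV \<in> clarke_jac T (base_T \<theta>) \<and> WZ \<in> clarke_jac G (base_G \<theta>) \<and> lhs UV WZ ** N = rhs UV WZ)"
proof -
  have "N = matrix_inv (lhs UV WZ) ** rhs UV WZ \<longleftrightarrow> lhs UV WZ ** N = rhs UV WZ"
    if "UV \<in> clarke_jac T (base_T \<theta>)" "WZ \<in> clarke_jac G (base_G \<theta>)" for UV WZ
    using matrix_inv_inverse[OF lhs_invertible[OF that assms]]
    by (metis matrix_mul_assoc matrix_mul_lid)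
  then show ?thesis unfolding J_def by blast
qed

text \<open>Inserting the step at \<theta>' applied to \<open>xs \<theta>\<close>: the contraction
  at \<theta>' absorbs a part \<kappa> q of the distance, and what remains is the change of the step
  in the parameter alone.\<close>

lemma xs_diff_le:
  assumes "\<theta> \<in> \<Theta>" "\<theta>' \<in> \<Theta>"
  defines "H \<equiv> \<lambda>z. T (join (part1 z) (part2 z - \<gamma> *\<^sub>R G z))"
  shows "(1 - \<kappa> * q) * norm (xs \<theta> - xs \<theta>') \<le> norm (H (join \<theta> (xs \<theta>)) - H (join \<theta>' (xs \<theta>)))"
proof -
  have H: "H (join \<theta> (xs \<theta>)) = xs \<theta>" if "\<theta> \<in> \<Theta>" for \<theta> using fixed[OF that] by (simp add: H_def)
  have "norm (H (join \<theta>' (xs \<theta>)) - H (join \<theta>' (xs \<theta>')))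
      \<le> \<kappa> * norm ((xs \<theta> - \<gamma> *\<^sub>R G (join \<theta>' (xs \<theta>))) - (xs \<theta>' - \<gamma> *\<^sub>R G (join \<theta>' (xs \<theta>'))))"
    unfolding H_def part1_join part2_join by (rule T_lip[OF assms(2)])
  also have "\<dots> \<le> \<kappa> * (q * norm (xs \<theta> - xs \<theta>'))" by (intro mult_left_mono G_step[OF assms(2)] \<kappa>)
  finally have "norm (H (join \<theta>' (xs \<theta>)) - xs \<theta>') \<le> \<kappa> * (q * norm (xs \<theta> - xs \<theta>'))"
    using H[OF assms(2)] by simp
  moreover have "norm (xs \<theta> - xs \<theta>') \<le> norm (xs \<theta> - H (join \<theta>' (xs \<theta>))) + norm (H (join \<theta>' (xs \<theta>)) - xs \<theta>')"
    using norm_triangle_ineq[of "xs \<theta> - H (join \<theta>' (xs \<theta>))" "H (join \<theta>' (xs \<theta>)) - xs \<theta>'"] by simp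
  ultimately show ?thesis using H[OF assms(1)] by (simp add: algebra_simps)
qed

lemma xs_ll: "locally_lipschitz_on \<Theta> xs"
  unfolding locally_lipschitz_on_def
proof
  fix \<theta>0 assume \<theta>0: "\<theta>0 \<in> \<Theta>"
  define H where "H = (\<lambda>z. T (join (part1 z) (part2 z - \<gamma> *\<^sub>R G z)))"
  have "locally_lipschitz_on S (\<lambda>z. join (part1 z) (part2 z - \<gamma> *\<^sub>R G z))"
    by (rule locally_lipschitz_on_join[OF locally_lipschitz_on_bounded_linear[OF bounded_linear_part1]
          locally_lipschitz_on_diff_scaleR[OF locally_lipschitz_on_bounded_linear[OF bounded_linear_part2] G_ll]])
  from locally_lipschitz_on_compose[OF this _ T_ll]
  have H_ll: "locally_lipschitz_on S H" unfolding H_def by (simp add: image_subset_iff)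
  let ?z = "join \<theta>0 (xs \<theta>0)" and ?\<delta> = "1 - \<kappa> * q"
  have \<delta>: "?\<delta> > 0" using contr by simp
  have "?z \<in> S" using \<theta>0 by simp
  then obtain e L where e: "e > 0" "L-lipschitz_on (ball ?z e \<inter> S) H"
    using bspec[OF H_ll[unfolded locally_lipschitz_on_def], of ?z] by blast
  have L: "L \<ge> 0" using e(2) lipschitz_on_nonneg by blast
  \<comment> \<open>\<open>H\<close> is Lipschitz only near (\<theta>0, xs \<theta>0), and
    continuity of \<open>xs\<close> is not yet known. The second term is chosen to force
    \<open>xs \<theta>\<close> within e/2 of \<open>xs \<theta>0\<close>.\<close>
  define d where "d = min (e / 2) (e / 2 * ?\<delta> / (L + 1))"
  have d: "d > 0" using e(1) \<delta> L by (simp add: d_def)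
  have de: "d \<le> e / 2" unfolding d_def by (rule min.cobounded1)
  \<comment> \<open>Both comparison points have second component \<open>xs \<theta>\<close>. Taking
    \<theta> = \<theta>0 makes its distance to \<open>xs \<theta>0\<close> zero, which proves
    nearness; nearness then allows arbitrary pairs.\<close>
  have bound: "?\<delta> * norm (xs \<theta> - xs \<theta>') \<le> L * dist \<theta> \<theta>'"
    if "\<theta> \<in> \<Theta>" "\<theta>' \<in> \<Theta>" "dist \<theta>0 \<theta> + dist (xs \<theta>0) (xs \<theta>) < e" "dist \<theta>0 \<theta>' + dist (xs \<theta>0) (xs \<theta>) < e" for \<theta> \<theta>'
  proof -
    have "join \<theta> (xs \<theta>) \<in> ball ?z e \<inter> S" "join \<theta>' (xs \<theta>) \<in> ball ?z e \<inter> S"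
      using that dist_join_le[of \<theta>0 "xs \<theta>0" \<theta> "xs \<theta>"] dist_join_le[of \<theta>0 "xs \<theta>0" \<theta>' "xs \<theta>"] by auto
    then have "norm (H (join \<theta> (xs \<theta>)) - H (join \<theta>' (xs \<theta>))) \<le> L * dist (join \<theta> (xs \<theta>)) (join \<theta>' (xs \<theta>))"
      using lipschitz_onD[OF e(2)] by (simp add: dist_norm)
    also have "\<dots> \<le> L * dist \<theta> \<theta>'"
      using dist_join_le[of \<theta> "xs \<theta>" \<theta>' "xs \<theta>"] L by (intro mult_left_mono) auto
    finally show ?thesis using xs_diff_le[OF that(1,2)] unfolding H_def by linarith
  qed
  have near: "dist (xs \<theta>0) (xs \<theta>) < e / 2" if \<theta>: "\<theta> \<in> ball \<theta>0 d \<inter> \<Theta>" for \<theta>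
  proof -
    have "?\<delta> * norm (xs \<theta>0 - xs \<theta>) \<le> L * dist \<theta>0 \<theta>"
      by (rule bound) (use \<theta> \<theta>0 de e in auto)
    also have "\<dots> \<le> (L + 1) * dist \<theta>0 \<theta>" by (intro mult_right_mono) auto
    also have "\<dots> < (L + 1) * d" using \<theta> L by (intro mult_strict_left_mono) auto
    also have "\<dots> \<le> (L + 1) * (e / 2 * ?\<delta> / (L + 1))" using L by (intro mult_left_mono) (auto simp: d_def)
    also have "\<dots> = ?\<delta> * (e / 2)" using L by (auto simp: field_simps)
    finally show ?thesis using \<delta> mult_less_cancel_left_pos unfolding dist_norm by blast
  qed
  have "(L / ?\<delta>)-lipschitz_on (ball \<theta>0 d \<inter> \<Theta>) xs"
  proof (rule lipschitz_onI)
    fix \<theta> \<theta>' assume A: "\<theta> \<in> ball \<theta>0 d \<inter> \<Theta>" "\<theta>' \<in> ball \<theta>0 d \<inter> \<Theta>"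
    have "?\<delta> * norm (xs \<theta> - xs \<theta>') \<le> L * dist \<theta> \<theta>'"
      by (rule bound) (use A near[OF A(1)] de in auto)
    then show "dist (xs \<theta>) (xs \<theta>') \<le> L / ?\<delta> * dist \<theta> \<theta>'" using \<delta> by (simp add: dist_norm field_simps)
  qed (use L \<delta> in simp)
  then show "\<exists>e>0. \<exists>L. L-lipschitz_on (ball \<theta>0 e \<inter> \<Theta>) xs" using d by blast
qed

lemma base_G_ll: "locally_lipschitz_on \<Theta> base_G"
  unfolding base_G_def
  by (intro locally_lipschitz_on_join xs_ll locally_lipschitz_on_bounded_linear bounded_linear_ident)

lemma base_T_ll: "locally_lipschitz_on \<Theta> base_T"
proof -
  have "locally_lipschitz_on \<Theta> (\<lambda>\<theta>. G (base_G \<theta>))"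
    using base_in_S by (intro locally_lipschitz_on_compose[OF base_G_ll _ G_ll]) auto
  then show ?thesis unfolding base_T_def base_G_def
    by (rule locally_lipschitz_on_join[OF locally_lipschitz_on_bounded_linear[OF bounded_linear_ident]
          locally_lipschitz_on_diff_scaleR[OF xs_ll]])
qed

lemma J_nonempty:
  assumes \<theta>: "\<theta> \<in> \<Theta>"
  shows "J \<theta> \<noteq> {}"
proof -
  obtain D where "conservative_jac_on S T D" using T_pd unfolding path_diff_on_def by blast
  then interpret T: path_differentiable S T D using open_S T_ll by unfold_locales
  obtain E where "conservative_jac_on S G E" using G_pd unfolding path_diff_on_def by blast
  then interpret G: path_differentiable S G E using open_S G_ll by unfold_locales
  have "clarke_jac T (base_T \<theta>) \<noteq> {}" "clarke_jac G (base_G \<theta>) \<noteq> {}"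
    by (rule T.clarke_jac_nonempty[OF base_in_S(1)[OF \<theta>]] G.clarke_jac_nonempty[OF base_in_S(2)[OF \<theta>]])+
  then show ?thesis unfolding J_def by blast
qed

text \<open>The compactness step shared by closed graph and local boundedness: only the Clarke
  Jacobians are made to converge, so the matrices \<open>Ns\<close> may be unbounded.\<close>

lemma J_subsequence:
  assumes \<theta>: "\<theta> \<in> \<Theta>" and \<theta>s: "\<theta>s \<longlonglongrightarrow> \<theta>" "\<And>n::nat. \<theta>s n \<in> \<Theta>" and Ns: "\<And>n. Ns n \<in> J (\<theta>s n)"
  obtains s UVs WZs UV WZ where "strict_mono s"
    "\<And>n. UVs n \<in> clarke_jac T (base_T (\<theta>s (s n)))" "\<And>n. WZs n \<in> clarke_jac G (base_G (\<theta>s (s n)))"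
    "\<And>n. lhs (UVs n) (WZs n) ** Ns (s n) = rhs (UVs n) (WZs n)"
    "UVs \<longlonglongrightarrow> UV" "WZs \<longlonglongrightarrow> WZ" "UV \<in> clarke_jac T (base_T \<theta>)" "WZ \<in> clarke_jac G (base_G \<theta>)"
proof -
  have "\<exists>UV WZ. UV \<in> clarke_jac T (base_T (\<theta>s n)) \<and> WZ \<in> clarke_jac G (base_G (\<theta>s n)) \<and> lhs UV WZ ** Ns n = rhs UV WZ" for n
    using Ns[of n] J_iff[OF \<theta>s(2)[of n]] by simp
  then obtain UVs WZs where U: "\<And>n. UVs n \<in> clarke_jac T (base_T (\<theta>s n))"
      and W: "\<And>n. WZs n \<in> clarke_jac G (base_G (\<theta>s n))" and eq: "\<And>n. lhs (UVs n) (WZs n) ** Ns n = rhs (UVs n) (WZs n)"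
    by metis
  have bT: "(\<lambda>n. base_T (\<theta>s n)) \<longlonglongrightarrow> base_T \<theta>"
    by (rule locally_lipschitz_on_tendsto[OF base_T_ll \<theta> \<theta>s])
  have bG: "(\<lambda>n. base_G (\<theta>s n)) \<longlonglongrightarrow> base_G \<theta>"
    by (rule locally_lipschitz_on_tendsto[OF base_G_ll \<theta> \<theta>s])
  obtain s UV where s: "strict_mono s" "(UVs \<circ> s) \<longlonglongrightarrow> UV" "UV \<in> clarke_jac T (base_T \<theta>)"
    by (rule clarke_jac_convergent_subsequence[OF open_S base_in_S(1)[OF \<theta>] T_ll bT U])
  have bG': "(\<lambda>n. base_G (\<theta>s (s n))) \<longlonglongrightarrow> base_G \<theta>"
    using LIMSEQ_subseq_LIMSEQ[OF bG s(1)] by (simp add: o_def)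
  obtain s' WZ where s': "strict_mono s'" "((\<lambda>n. WZs (s n)) \<circ> s') \<longlonglongrightarrow> WZ" "WZ \<in> clarke_jac G (base_G \<theta>)"
    by (rule clarke_jac_convergent_subsequence[OF open_S base_in_S(2)[OF \<theta>] G_ll bG' W])
  show thesis
  proof (rule that[of "\<lambda>n. s (s' n)" "\<lambda>n. UVs (s (s' n))" "\<lambda>n. WZs (s (s' n))" UV WZ])
    show "strict_mono (\<lambda>n. s (s' n))" using s(1) s'(1) by (simp add: strict_mono_def)
    show "(\<lambda>n. UVs (s (s' n))) \<longlonglongrightarrow> UV" using LIMSEQ_subseq_LIMSEQ[OF s(2) s'(1)] by (simp add: o_def)
    show "(\<lambda>n. WZs (s (s' n))) \<longlonglongrightarrow> WZ" using s'(2) by (simp add: o_def)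
  qed (use U W eq s(3) s'(3) in auto)
qed

lemma tendsto_lhs_rhs:
  assumes "UVs \<longlonglongrightarrow> UV" "WZs \<longlonglongrightarrow> WZ"
  shows "(\<lambda>n. lhs (UVs n) (WZs n)) \<longlonglongrightarrow> lhs UV WZ" "(\<lambda>n. rhs (UVs n) (WZs n)) \<longlonglongrightarrow> rhs UV WZ"
  unfolding lhs_def rhs_def
  by (intro tendsto_diff tendsto_const tendsto_scaleR tendsto_matrix_matrix_mult tendsto_blockU tendsto_blockV assms)+

lemma J_closed_graph: "closedin (top_of_set (\<Theta> \<times> UNIV)) (SIGMA \<theta>:\<Theta>. J \<theta>)"
  unfolding closed_graph_iff_sequential
proof (intro allI impI)
  fix \<theta>s \<theta> Ns N
  assume \<theta>s: "\<forall>n::nat. \<theta>s n \<in> \<Theta>" "\<theta> \<in> \<Theta>" "\<theta>s \<longlonglongrightarrow> \<theta>" "\<forall>n. Ns n \<in> J (\<theta>s n)" and N: "Ns \<longlonglongrightarrow> N"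
  obtain s UVs WZs UV WZ where s: "strict_mono s"
    and eq: "\<And>n. lhs (UVs n) (WZs n) ** Ns (s n) = rhs (UVs n) (WZs n)"
    and lim: "UVs \<longlonglongrightarrow> UV" "WZs \<longlonglongrightarrow> WZ" and UV: "UV \<in> clarke_jac T (base_T \<theta>)" "WZ \<in> clarke_jac G (base_G \<theta>)"
    using J_subsequence[OF \<theta>s(2,3) \<theta>s(1)[rule_format] \<theta>s(4)[rule_format]] by metis
  have "(\<lambda>n. Ns (s n)) \<longlonglongrightarrow> N" using LIMSEQ_subseq_LIMSEQ[OF N s] by (simp add: o_def)
  then have "(\<lambda>n. lhs (UVs n) (WZs n) ** Ns (s n)) \<longlonglongrightarrow> lhs UV WZ ** N"
    by (intro tendsto_matrix_matrix_mult tendsto_lhs_rhs lim)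
  then have "(\<lambda>n. rhs (UVs n) (WZs n)) \<longlonglongrightarrow> lhs UV WZ ** N" by (simp add: eq)
  then have "lhs UV WZ ** N = rhs UV WZ" using tendsto_lhs_rhs(2)[OF lim] LIMSEQ_unique by blast
  then show "N \<in> J \<theta>" using UV J_iff[OF \<theta>s(2)] by blast
qed

text \<open>Otherwise some elements of \<open>J\<close> at points tending to \<theta> have norms
  above n. Along a subsequence the right-hand sides converge, and the uniform lower bound on
  \<open>lhs\<close> turns this into a bound on those elements.\<close>

lemma J_locally_bounded:
  assumes \<theta>: "\<theta> \<in> \<Theta>"
  shows "\<exists>e>0. bounded (\<Union> (J ` (ball \<theta> e \<inter> \<Theta>)))"
proof (rule ccontr)
  assume *: "\<not> ?thesis"
  have "\<exists>\<theta>' N. \<theta>' \<in> ball \<theta> (1 / real (Suc n)) \<inter> \<Theta> \<and> N \<in> J \<theta>' \<and> norm N > real n" for n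
  proof (rule ccontr)
    assume n: "\<not> ?thesis"
    have "bounded (\<Union> (J ` (ball \<theta> (1 / real (Suc n)) \<inter> \<Theta>)))"
      by (rule boundedI[of _ "real n"]) (use n in force)
    then show False using * by (metis of_nat_0_less_iff zero_less_Suc zero_less_divide_1_iff)
  qed
  then obtain \<theta>s Ns where \<theta>s: "\<And>n. \<theta>s n \<in> ball \<theta> (1 / real (Suc n)) \<inter> \<Theta>" and Ns: "\<And>n. Ns n \<in> J (\<theta>s n)"
      and big: "\<And>n. norm (Ns n) > real n"
    by metis
  have lim\<theta>: "\<theta>s \<longlonglongrightarrow> \<theta>"
    by (rule metric_tendsto_imp_tendsto[OF LIMSEQ_inverse_real_of_nat])
      (use \<theta>s in \<open>auto simp: dist_commute inverse_eq_divide intro!: always_eventually less_imp_le\<close>)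
  have in\<Theta>: "\<theta>s n \<in> \<Theta>" for n using \<theta>s by blast
  obtain s UVs WZs UV WZ where s: "strict_mono s"
    and U: "\<And>n. UVs n \<in> clarke_jac T (base_T (\<theta>s (s n)))" "\<And>n. WZs n \<in> clarke_jac G (base_G (\<theta>s (s n)))"
    and eq: "\<And>n. lhs (UVs n) (WZs n) ** Ns (s n) = rhs (UVs n) (WZs n)"
    and lim: "UVs \<longlonglongrightarrow> UV" "WZs \<longlonglongrightarrow> WZ"
    using J_subsequence[OF \<theta> lim\<theta> in\<Theta> Ns] by metis
  have "bounded (range (\<lambda>n. rhs (UVs n) (WZs n)))"
    using tendsto_lhs_rhs(2)[OF lim] convergent_imp_bounded by blast
  then obtain b where b: "\<And>n. norm (rhs (UVs n) (WZs n)) \<le> b" unfolding bounded_iff by blast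
  have \<delta>: "1 - \<kappa> * q > 0" using contr by simp
  have "Ns (s n) \<in> {M. \<forall>h. norm (M *v h) \<le> b / (1 - \<kappa> * q) * norm h}" for n
  proof (intro CollectI allI)
    fix h
    have "(1 - \<kappa> * q) * norm (Ns (s n) *v h) \<le> norm (lhs (UVs n) (WZs n) *v (Ns (s n) *v h))"
      by (rule lhs_norm_ge[OF U in\<Theta>])
    also have "\<dots> = norm (rhs (UVs n) (WZs n) *v h)"
      by (simp add: matrix_vector_mul_assoc eq)
    also have "\<dots> \<le> norm (rhs (UVs n) (WZs n)) * norm h" by (rule norm_matrix_vector_mult_le)
    also have "\<dots> \<le> b * norm h" by (intro mult_right_mono b) simp
    finally show "norm (Ns (s n) *v h) \<le> b / (1 - \<kappa> * q) * norm h" using \<delta> by (simp add: field_simps)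
  qed
  moreover obtain C where "\<And>M :: real^'p^'n. M \<in> {M. \<forall>h. norm (M *v h) \<le> b / (1 - \<kappa> * q) * norm h} \<Longrightarrow> norm M \<le> C"
    using bounded_operator_norm_le[of "b / (1 - \<kappa> * q)"] unfolding bounded_iff by blast
  ultimately have C: "norm (Ns (s n)) \<le> C" for n by blast
  obtain n where "real n > C" using reals_Archimedean2 by blast
  moreover have "real n \<le> real (s n)" using seq_suble[OF s] by simp
  ultimately show False using C[of n] big[of "s n"] by linarith
qed

lemma J_curve:
  assumes c: "abs_cont_on 0 1 c" "c ` {0..1} \<subseteq> \<Theta>"
  shows "\<exists>N \<in> null_sets lebesgue. \<forall>t \<in> {0..1} - N.
           \<exists>v. (c has_vector_derivative v) (at t) \<and>
               (\<forall>M \<in> J (c t). ((xs \<circ> c) has_vector_derivative (M *v v)) (at t))"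
proof -
  obtain D where "conservative_jac_on S T D" using T_pd unfolding path_diff_on_def by blast
  then interpret T: path_differentiable S T D using open_S T_ll by unfold_locales
  obtain E where "conservative_jac_on S G E" using G_pd unfolding path_diff_on_def by blast
  then interpret G: path_differentiable S G E using open_S G_ll by unfold_locales
  have cS: "(base_T \<circ> c) ` {0..1} \<subseteq> S" "(base_G \<circ> c) ` {0..1} \<subseteq> S"
    using c(2) by (auto simp: base_T_def base_G_def)
  obtain N1 where N1: "N1 \<in> null_sets lebesgue" and
    T': "\<And>t. t \<in> {0..1} - N1 \<Longrightarrow> \<exists>v. (base_T \<circ> c has_vector_derivative v) (at t) \<and>
       (\<forall>M \<in> clarke_jac T ((base_T \<circ> c) t). (T \<circ> (base_T \<circ> c) has_vector_derivative (M *v v)) (at t))"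
    using T.clarke_jac_curve[OF abs_cont_on_locally_lipschitz_compose[OF c base_T_ll] cS(1)] by metis
  obtain N2 where N2: "N2 \<in> null_sets lebesgue" and
    G': "\<And>t. t \<in> {0..1} - N2 \<Longrightarrow> \<exists>v. (base_G \<circ> c has_vector_derivative v) (at t) \<and>
       (\<forall>M \<in> clarke_jac G ((base_G \<circ> c) t). (G \<circ> (base_G \<circ> c) has_vector_derivative (M *v v)) (at t))"
    using G.clarke_jac_curve[OF abs_cont_on_locally_lipschitz_compose[OF c base_G_ll] cS(2)] by metis
  \<comment> \<open>The endpoints are discarded: derivatives are two-sided, while the curve is known
    to stay in \<Theta> only for times in the unit interval.\<close>
  have "{0, 1} \<in> null_sets lebesgue"
    unfolding negligible_iff_null_sets[symmetric] by (intro negligible_finite) simp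
  then have "N1 \<union> N2 \<union> {0, 1} \<in> null_sets lebesgue" using N1 N2 by (intro null_sets.Un)
  moreover have "\<exists>v. (c has_vector_derivative v) (at t) \<and>
               (\<forall>M \<in> J (c t). ((xs \<circ> c) has_vector_derivative (M *v v)) (at t))"
    if t: "t \<in> {0..1} - (N1 \<union> N2 \<union> {0, 1})" for t
  proof -
    have ct: "c t \<in> \<Theta>" and t01: "t \<in> {0<..<1}" using t c(2) by auto
    obtain a where a: "(base_G \<circ> c has_vector_derivative a) (at t)"
      "\<And>WZ. WZ \<in> clarke_jac G (base_G (c t)) \<Longrightarrow> (G \<circ> (base_G \<circ> c) has_vector_derivative (WZ *v a)) (at t)"
      using G'[of t] t by auto
    obtain b where b: "(base_T \<circ> c has_vector_derivative b) (at t)"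
      "\<And>UV. UV \<in> clarke_jac T (base_T (c t)) \<Longrightarrow> (T \<circ> (base_T \<circ> c) has_vector_derivative (UV *v b)) (at t)"
      using T'[of t] t by auto
    define v w where "v = part1 a" and "w = part2 a"
    \<comment> \<open>Differentiability of \<open>c\<close> and of \<open>xs \<circ> c\<close> is
      read off from the two components of the lifted curve \<open>base_G \<circ> c\<close>.\<close>
    have c': "(c has_vector_derivative v) (at t)"
      using bounded_linear.has_vector_derivative[OF bounded_linear_part1 a(1)]
      by (simp add: base_G_def v_def)
    have x': "(xs \<circ> c has_vector_derivative w) (at t)"
      using bounded_linear.has_vector_derivative[OF bounded_linear_part2 a(1)]
      by (simp add: base_G_def w_def o_def)
    have b1: "part1 b = v"
    proof (rule vector_derivative_unique_at[OF _ c'])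
      show "(c has_vector_derivative part1 b) (at t)"
        using bounded_linear.has_vector_derivative[OF bounded_linear_part1 b(1)] by (simp add: base_T_def)
    qed
    have "M *v v = w" if M: "M \<in> J (c t)" for M
    proof -
      obtain UV WZ where UV: "UV \<in> clarke_jac T (base_T (c t))" "WZ \<in> clarke_jac G (base_G (c t))"
        and eq: "lhs UV WZ ** M = rhs UV WZ" using M J_iff[OF ct] by blast
      have b2: "part2 b = w - \<gamma> *\<^sub>R (WZ *v a)"
      proof (rule vector_derivative_unique_at)
        show "((\<lambda>t. xs (c t) - \<gamma> *\<^sub>R G (base_G (c t))) has_vector_derivative part2 b) (at t)"
          using bounded_linear.has_vector_derivative[OF bounded_linear_part2 b(1)]
          by (simp add: base_T_def base_G_def)
        show "((\<lambda>t. xs (c t) - \<gamma> *\<^sub>R G (base_G (c t))) has_vector_derivative w - \<gamma> *\<^sub>R (WZ *v a)) (at t)"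
          using x' a(2)[OF UV(2)]
          by (intro has_vector_derivative_diff bounded_linear.has_vector_derivative[OF bounded_linear_scaleR_right])
            (simp_all add: o_def)
      qed
      \<comment> \<open>By the fixed point equation \<open>xs \<circ> c\<close> agrees with the
        composite of \<open>T\<close> and \<open>base_T \<circ> c\<close> on the open unit interval,
        so the chain rule for \<open>T\<close> computes its derivative.\<close>
      have "w = UV *v b"
      proof (rule vector_derivative_unique_at[OF x'])
        show "(xs \<circ> c has_vector_derivative UV *v b) (at t)"
          by (rule has_vector_derivative_transform_within_open[OF b(2)[OF UV(1)] open_greaterThanLessThan t01])
            (use fixed c(2) in \<open>auto simp: base_T_def image_subset_iff\<close>)
      qed
      moreover have "a = join v w" "b = join v (w - \<gamma> *\<^sub>R (WZ *v a))"
        unfolding v_def w_def using b1 b2 by (simp, metis join_parts v_def w_def)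
      ultimately have "w = blockU UV *v v + blockV UV *v (w - \<gamma> *\<^sub>R (blockU WZ *v v + blockV WZ *v w))"
        by (metis matrix_vector_mult_join)
      then have "lhs UV WZ *v w = rhs UV WZ *v v"
        by (simp add: lhs_def rhs_def matrix_vector_mult_diff_rdistrib matrix_vector_mult_diff_distrib
            matrix_vector_mul_assoc[symmetric] scaleR_matrix_vector_assoc[symmetric] matrix_vector_mult_scaleR
            matrix_vector_right_distrib algebra_simps)
      also have "\<dots> = lhs UV WZ *v (M *v v)" by (simp add: eq[symmetric] matrix_vector_mul_assoc)
      finally have "(1 - \<kappa> * q) * norm (w - M *v v) \<le> 0"
        using lhs_norm_ge[OF UV ct, of "w - M *v v"] by (simp add: matrix_vector_mult_diff_distrib)
      then show ?thesis using contr by (simp add: mult_le_0_iff)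
    qed
    then show ?thesis using c' x' by auto
  qed
  ultimately show ?thesis by blast
qed

lemma conservative_J: "conservative_jac_on \<Theta> xs J"
  unfolding conservative_jac_on_def
  using J_nonempty J_locally_bounded J_closed_graph J_curve by blast

lemma path_diff_xs: "path_diff_on \<Theta> xs"
  unfolding path_diff_on_def using xs_ll conservative_J by blast

end

section \<open>Solution maps of composite problems\<close>

text \<open>The final conjunct certifies that the formula contains genuine inverses, as
  \<open>matrix_inv\<close> is defined by a choice that is arbitrary at singular matrices.\<close>

theorem theorem3:
  fixes \<Theta> :: "(real^'p) set"
    and f :: "real^'p \<Rightarrow> real^'n \<Rightarrow> real"
    and g :: "real^'p \<Rightarrow> real^'n \<Rightarrow> ereal"
    and \<alpha> \<beta> \<gamma> :: real
  assumes \<Theta>: "open \<Theta>" "connected \<Theta>" "\<Theta> \<noteq> {}"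
    and \<beta>: "\<beta> > 0" and \<alpha>: "\<alpha> > 0"
    and f_conv: "\<forall>\<theta>\<in>\<Theta>. convex_on UNIV (f \<theta>)"
    and f_C1: "\<forall>\<theta>\<in>\<Theta>. (\<forall>x. f \<theta> differentiable (at x)) \<and> continuous_on UNIV (grad (f \<theta>))"
    and f_lip: "\<forall>\<theta>\<in>\<Theta>. \<beta>-lipschitz_on UNIV (grad (f \<theta>))"
    and g_ccp: "\<forall>\<theta>\<in>\<Theta>. ext_convex (g \<theta>) \<and> ext_closed (g \<theta>) \<and> ext_proper (g \<theta>)"
    and strong: "(\<forall>\<theta>\<in>\<Theta>. ext_strongly_convex \<alpha> (\<lambda>x. ereal (f \<theta> x)))
                 \<or> (\<forall>\<theta>\<in>\<Theta>. ext_strongly_convex \<alpha> (g \<theta>))"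
    and \<gamma>: "\<gamma> = \<alpha> / (\<alpha> + \<beta>)\<^sup>2"
    and T_pd: "path_diff_on {z. part1 z \<in> \<Theta>}
                 (\<lambda>z. prox (\<lambda>u. ereal \<gamma> * g (part1 z) u) (part2 z))"
    and gradf_pd: "path_diff_on {z. part1 z \<in> \<Theta>} (\<lambda>z. grad (f (part1 z)) (part2 z))"
  shows "(\<forall>\<theta>\<in>\<Theta>. \<exists>!x. is_minimizer (\<lambda>y. ereal (f \<theta> y) + g \<theta> y) x) \<and>
    (let xs = (\<lambda>\<theta>. THE x. is_minimizer (\<lambda>y. ereal (f \<theta> y) + g \<theta> y) x);
         T = (\<lambda>z. prox (\<lambda>u. ereal \<gamma> * g (part1 z) u) (part2 z));
         G = (\<lambda>z. grad (f (part1 z)) (part2 z));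
         J = (\<lambda>\<theta>. {matrix_inv (mat 1 - blockV UV ** (mat 1 - \<gamma> *\<^sub>R blockV WZ))
                     ** (blockU UV - \<gamma> *\<^sub>R (blockV UV ** blockU WZ)) | UV WZ.
                   UV \<in> clarke_jac T (join \<theta> (xs \<theta> - \<gamma> *\<^sub>R grad (f \<theta>) (xs \<theta>))) \<and>
                   WZ \<in> clarke_jac G (join \<theta> (xs \<theta>))})
     in path_diff_on \<Theta> xs \<and> conservative_jac_on \<Theta> xs J \<and>
        (\<forall>\<theta>\<in>\<Theta>. \<forall>UV \<in> clarke_jac T (join \<theta> (xs \<theta> - \<gamma> *\<^sub>R grad (f \<theta>) (xs \<theta>))).
           \<forall>WZ \<in> clarke_jac G (join \<theta> (xs \<theta>)).
             invertible (mat 1 - blockV UV ** (mat 1 - \<gamma> *\<^sub>R blockV WZ))))"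
proof -
  have \<gamma>0: "\<gamma> > 0" using \<alpha> \<beta> by (simp add: \<gamma>)
  have "\<gamma> * \<beta>\<^sup>2 < \<gamma> * (\<alpha> + \<beta>)\<^sup>2"
    using \<gamma>0 \<alpha> \<beta> by (intro mult_strict_left_mono power_strict_mono) auto
  also have "\<gamma> * (\<alpha> + \<beta>)\<^sup>2 = \<alpha>" using \<alpha> \<beta> by (simp add: \<gamma>)
  finally have \<gamma>\<beta>: "\<gamma>\<^sup>2 * \<beta>\<^sup>2 < \<gamma> * \<alpha>"
    using mult_strict_left_mono[of "\<gamma> * \<beta>\<^sup>2" \<alpha> \<gamma>] \<gamma>0 by (simp add: power2_eq_square mult.assoc)
  \<comment> \<open>Moduli (\<alpha>, 0) or (0, \<alpha>) merge the two alternatives. Since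
    \<gamma>^2 \<beta>^2 < \<gamma> \<alpha>, the first radicand is below 1 - \<gamma> \<alpha>, and
    the second, 1 + \<gamma>^2 \<beta>^2, is below (1 + \<gamma> \<alpha>)^2.\<close>
  obtain \<mu>f \<mu>g where \<mu>: "0 \<le> \<mu>f" "0 \<le> \<mu>g" "0 < \<mu>f + \<mu>g"
    and fsc: "\<And>\<theta>. \<theta> \<in> \<Theta> \<Longrightarrow> epi_convex \<mu>f (\<lambda>x. ereal (f \<theta> x))"
    and gsc: "\<And>\<theta>. \<theta> \<in> \<Theta> \<Longrightarrow> epi_convex \<mu>g (g \<theta>)"
    and contr: "1 / (1 + \<gamma> * \<mu>g) * sqrt (1 - 2 * \<gamma> * \<mu>f + \<gamma>\<^sup>2 * \<beta>\<^sup>2) < 1"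
  proof (cases "\<forall>\<theta>\<in>\<Theta>. ext_strongly_convex \<alpha> (\<lambda>x. ereal (f \<theta> x))")
    case True
    have "sqrt (1 - 2 * \<gamma> * \<alpha> + \<gamma>\<^sup>2 * \<beta>\<^sup>2) < 1"
      using \<gamma>\<beta> mult_pos_pos[OF \<gamma>0 \<alpha>] by (subst real_sqrt_lt_1_iff) linarith
    then show thesis
      using True \<alpha> g_ccp by (intro that[of \<alpha> 0] ext_strongly_convex_imp_epi_convex ext_convex_imp_epi_convex) auto
  next
    case False
    then have "\<forall>\<theta>\<in>\<Theta>. ext_strongly_convex \<alpha> (g \<theta>)" using strong by blast
    moreover have "sqrt (1 + \<gamma>\<^sup>2 * \<beta>\<^sup>2) < 1 + \<gamma> * \<alpha>"
    proof (rule real_less_lsqrt)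
      show "0 \<le> 1 + \<gamma> * \<alpha>" using \<gamma>0 \<alpha> by simp
      have "(1 + \<gamma> * \<alpha>)\<^sup>2 = 1 + 2 * (\<gamma> * \<alpha>) + (\<gamma> * \<alpha>)\<^sup>2" by (simp add: power2_eq_square algebra_simps)
      moreover have "0 < \<gamma> * \<alpha>" using \<gamma>0 \<alpha> by simp
      ultimately show "1 + \<gamma>\<^sup>2 * \<beta>\<^sup>2 < (1 + \<gamma> * \<alpha>)\<^sup>2" using \<gamma>\<beta> zero_le_power2[of "\<gamma> * \<alpha>"] by linarith
    qed
    ultimately show thesis
      using \<alpha> f_conv \<gamma>0 by (intro that[of 0 \<alpha>] ext_strongly_convex_imp_epi_convex convex_on_imp_epi_convex)
        (auto simp: pos_divide_less_eq add_pos_pos)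
  qed
  have df: "f \<theta> differentiable (at x)" if "\<theta> \<in> \<Theta>" for \<theta> x using f_C1 that by blast
  have ex1: "\<exists>!x. is_minimizer (\<lambda>y. ereal (f \<theta> y) + g \<theta> y) x" if \<theta>: "\<theta> \<in> \<Theta>" for \<theta>
  proof -
    have "continuous_on UNIV (f \<theta>)"
      by (intro differentiable_imp_continuous_on differentiable_at_imp_differentiable_on df \<theta>)
    then have "\<exists>!x. is_minimizer (\<lambda>y. g \<theta> y + ereal (f \<theta> y)) x"
      using \<mu> g_ccp \<theta>
      by (intro strongly_convex_ex1_minimizer[OF epi_convex_add_real[OF gsc fsc]]
          ext_closed_add_real ext_proper_add_real) auto
    then show ?thesis by (simp add: add.commute)
  qed
  define xs where "xs = (\<lambda>\<theta>. THE x. is_minimizer (\<lambda>y. ereal (f \<theta> y) + g \<theta> y) x)"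
  define T where "T = (\<lambda>z :: real^('p + 'n). prox (\<lambda>u. ereal \<gamma> * g (part1 z) u) (part2 z))"
  define G where "G = (\<lambda>z :: real^('p + 'n). grad (f (part1 z)) (part2 z))"
  interpret P: parametric_fixed_point \<Theta> T G xs \<gamma> "1 / (1 + \<gamma> * \<mu>g)" "sqrt (1 - 2 * \<gamma> * \<mu>f + \<gamma>\<^sup>2 * \<beta>\<^sup>2)"
  proof
    show "open \<Theta>" by (rule \<Theta>)
    show "path_diff_on {z. part1 z \<in> \<Theta>} T" "path_diff_on {z. part1 z \<in> \<Theta>} G"
      unfolding T_def G_def by (rule T_pd gradf_pd)+
    show "0 \<le> 1 / (1 + \<gamma> * \<mu>g)" using \<gamma>0 \<mu> by simp
    show "1 / (1 + \<gamma> * \<mu>g) * sqrt (1 - 2 * \<gamma> * \<mu>f + \<gamma>\<^sup>2 * \<beta>\<^sup>2) < 1" by (rule contr)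
  next
    fix \<theta> and x y :: "real^'n" assume \<theta>: "\<theta> \<in> \<Theta>"
    show "norm (T (join \<theta> x) - T (join \<theta> y)) \<le> 1 / (1 + \<gamma> * \<mu>g) * norm (x - y)"
      unfolding T_def part1_join part2_join using \<gamma>0 \<mu> g_ccp \<theta>
      by (intro prox_lipschitz epi_convex_cmult gsc ext_closed_cmult ext_proper_cmult) auto
    show "norm ((x - \<gamma> *\<^sub>R G (join \<theta> x)) - (y - \<gamma> *\<^sub>R G (join \<theta> y)))
        \<le> sqrt (1 - 2 * \<gamma> * \<mu>f + \<gamma>\<^sup>2 * \<beta>\<^sup>2) * norm (x - y)"
      unfolding G_def part1_join part2_join using \<gamma>0 f_lip \<theta>
      by (intro gradient_step_norm_le fsc df) auto
  next
    fix \<theta> assume \<theta>: "\<theta> \<in> \<Theta>"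
    have "is_minimizer (\<lambda>y. ereal (f \<theta> y) + g \<theta> y) (xs \<theta>)"
      unfolding xs_def by (rule theI'[OF ex1[OF \<theta>]])
    then show "T (join \<theta> (xs \<theta> - \<gamma> *\<^sub>R G (join \<theta> (xs \<theta>)))) = xs \<theta>"
      unfolding T_def G_def part1_join part2_join using g_ccp \<theta> \<gamma>0
      by (intro minimizer_sum_prox_fixed_point ext_convex_imp_epi_convex df) auto
  qed
  have base_T: "P.base_T \<theta> = join \<theta> (xs \<theta> - \<gamma> *\<^sub>R grad (f \<theta>) (xs \<theta>))" for \<theta>
    unfolding P.base_T_def by (simp add: G_def)
  note defs = P.J_def[abs_def] P.lhs_def P.rhs_def base_T P.base_G_def
  have "path_diff_on \<Theta> xs" by (rule P.path_diff_xs)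
  moreover have "conservative_jac_on \<Theta> xs P.J" by (rule P.conservative_J)
  moreover have "\<forall>\<theta>\<in>\<Theta>. \<forall>UV \<in> clarke_jac T (P.base_T \<theta>). \<forall>WZ \<in> clarke_jac G (P.base_G \<theta>). invertible (P.lhs UV WZ)"
    using P.lhs_invertible by blast
  ultimately show ?thesis
    using ex1 unfolding defs unfolding Let_def xs_def T_def G_def by blast
qed

end
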